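(* Let $q$ be a positive integer, let $s,s'\in\mathbb Z^m$ have all coordinates coprime to $q$, and let $\epsilon\in\{\pm1\}$. (a) If $q$ is odd, there is an $\epsilon$-oriented isometry $\psi$ between $L(q;s)$ and $L(q;s')$ if and only if there is an $\epsilon$-oriented $\|\cdot\|_1$-isometry $\varphi$ between $\mathcal L(q;s)$ and $\mathcal L(q;s')$ (i.e. with $\varphi(\mathcal L(q;s))=\mathcal L(q;s')$). (b) If $q$ is even (and $m$ is even, so that spin structures exist) and $\rho\in\{0,1\}$, there is an $\epsilon$-oriented isometry $\psi$ between $L(q;s)$ and $L(q;s')$ taking the spin structures $\tau_h$ to $\tau'_{h+\rho}$ for $h=0,1$ if and only if there is an $\epsilon$-oriented $\|\cdot\|_1$-isometry $\varphi$ with $\varphi(\mathcal L(q;s;h))=\mathcal L(q;s';h+\rho)$ for $h=0,1$.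
   Context: Lens spaces. $L(q;s)=\Gamma\backslash S^{2m-1}$, where $\Gamma=\langle\gamma\rangle$ and $\gamma\in \mathrm{SO}(2m)$ is block diagonal with $j$-th $2\times2$ block the rotation by $2\pi s_j/q$; $S^{2m-1}$ is the round unit sphere and lens spaces carry the orientation induced from a fixed orientation of $S^{2m-1}$. Let $\Theta:\mathrm{Spin}(2m)\to\mathrm{SO}(2m)$ be the double cover, $\mathrm{Spin}(2m)$ inside the Clifford algebra of $\mathbb R^{2m}$ ($e_i^2=-1$). For $q,m$ even, put $h_{q;s}=\sum_j\lfloor s_j/q\rfloor$; the two spin structures $\tau_0,\tau_1$ of $L(q;s)$ are induced by the homomorphisms $\tau_h:\Gamma\to\mathrm{Spin}(2m)$, $\Theta\circ\tau_h=\mathrm{Id}_\Gamma$, $\tau_h(\gamma^k)=(-1)^{k(h+h_{q;s})}\prod_{j=1}^m\big(\cos(\tfrac{ks_j\pi}{q})+\sin(\tfrac{ks_j\pi}{q})\,e_{2j-1}e_{2j}\big)$ (depending only on the parity of $h$); $\tau'_h$ denotes those of $L(q;s')=\Gamma'\backslash S^{2m-1}$. An isometry $\psi:L(q;s)\to L(q;s')$ lifts to some $\Psi\in\mathrm O(2m)$ with $\Psi\Gamma\Psi^{-1}=\Gamma'$; $\psi$ takes $\tau$ to $\tau'$ if $\tau'(\Psi g\Psi^{-1})=\widetilde\Psi\tau(g)\widetilde\Psi^{-1}$ for all $g\in\Gamma$, where $\widetilde\Psi\in\mathrm{Pin}(2m)$ is a lift of $\Psi$. An isometry is $\epsilon$-oriented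 if it preserves orientation when $\epsilon=1$ and reverses orientation when $\epsilon=-1$. Lattices. Let $\mathbb E^m=(\tfrac12+\mathbb Z)^m$, with elements written $\tfrac12(a_1,\dots,a_m)$, $a_j$ odd integers. $\mathcal L(q;s)=\{\tfrac12(a_1,\dots,a_m)\in\mathbb E^m:\sum_ja_js_j\equiv0\pmod q\}$ and, for $q$ even and $h\in\mathbb Z$, $\mathcal L(q;s;h)=\{\tfrac12(a_1,\dots,a_m)\in\mathbb E^m:\sum_ja_js_j\equiv hq\pmod{2q}\}$. A $\|\cdot\|_1$-isometry is a map $\varphi:\mathbb E^m\to\mathbb E^m$ of the form $\varphi(\tfrac12(a_1,\dots,a_m))=\tfrac12(\epsilon_{\sigma^{-1}(1)}a_{\sigma^{-1}(1)},\dots,\epsilon_{\sigma^{-1}(m)}a_{\sigma^{-1}(m)})$ with $\sigma$ a permutation of $\{1,\dots,m\}$ and $\epsilon_j\in\{\pm1\}$; it is $\epsilon$-oriented if $\prod_j\epsilon_j=\epsilon$.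
   Formalization: In (b) the lattice condition is φ(L(q;s;h+h_{q;s})) = L(q;s';h+ρ+h_{q;s'}); as printed it fails, e.g. q=2, s=(1,1), s'=(3,1), ε=1, ρ=0. The two agree when h_{q;s} and h_{q;s'} have the same parity, e.g. for 0≤s_j,s'_j<q. *)

theory Defs
  imports "HOL-Analysis.Analysis" "HOL-Number_Theory.Cong"
begin

section \<open>Coordinates\<close>

text \<open>
  The set \<open>{1, \<dots>, m}\<close> is a finite linearly ordered type \<open>'m\<close>, and \<open>\<real>\<^sup>2\<^sup>m\<close> is
  \<open>real ^ ('m \<times> bool)\<close>: the \<open>j\<close>-th \<open>2 \<times> 2\<close> block consists of the coordinates \<open>(j, False)\<close>
  and \<open>(j, True)\<close>, that is, of the coordinates numbered \<open>2j - 1\<close> and \<open>2j\<close>.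
\<close>

definition coord_number :: "'m::{finite,linorder} \<times> bool \<Rightarrow> nat" where
  "coord_number i = 2 * card {k. k < fst i} + (if snd i then 2 else 1)"


section \<open>The Clifford algebra of \<open>\<real>\<^sup>2\<^sup>m\<close> with \<open>e\<^sub>i\<^sup>2 = -1\<close>\<close>

text \<open>
  An element is the family of its coordinates with respect to the basis of the ordered products
  \<open>e\<^sub>A\<close>, where \<open>A\<close> ranges over the sets of coordinates.
\<close>

typedef 'm clifford = "UNIV :: (('m \<times> bool) set \<Rightarrow> real) set"
  morphisms cl_coeff Clifford ..

setup_lifting type_definition_clifford

lemma clifford_eqI: "(\<And>A. cl_coeff x A = cl_coeff y A) \<Longrightarrow> x = y"
  by transfer auto

text \<open>
  \<open>e\<^sub>A e\<^sub>B = blade_sign A B *\<^sub>R e\<^bsub>sym_diff A B\<^esub>\<close>: sorting the product interchanges \<open>e\<^sub>a\<close> and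
  \<open>e\<^sub>b\<close> whenever \<open>b\<close> precedes \<open>a\<close>, and each common index contributes \<open>e\<^sub>a\<^sup>2 = -1\<close>.
\<close>

definition blade_sign :: "('m::{finite,linorder} \<times> bool) set \<Rightarrow> ('m \<times> bool) set \<Rightarrow> real" where
  "blade_sign A B = (\<Prod>a\<in>A. \<Prod>b\<in>B. if coord_number b \<le> coord_number a then -1 else 1)"

lemma prod_sym_diff_sign:
  fixes f :: "'a \<Rightarrow> real"
  assumes "finite A" "finite B" "\<And>x. f x * f x = 1"
  shows "prod f (sym_diff A B) = prod f A * prod f B"
proof -
  have sq: "prod f C * prod f C = 1" for C
    by (simp add: prod.distrib[symmetric] assms(3))
  have A: "prod f A = prod f (A - B) * prod f (A \<inter> B)"
    using assms(1) by (subst prod.union_disjoint[symmetric]) (auto intro: prod.cong)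
  have B: "prod f B = prod f (B - A) * prod f (A \<inter> B)"
    using assms(2) by (subst prod.union_disjoint[symmetric]) (auto intro: prod.cong)
  have "prod f (sym_diff A B) = prod f (A - B) * prod f (B - A)"
    using assms by (intro prod.union_disjoint) auto
  also have "\<dots> = prod f (A - B) * prod f (B - A) * (prod f (A \<inter> B) * prod f (A \<inter> B))"
    by (simp add: sq)
  finally show ?thesis unfolding A B by simp
qed

lemma blade_sign_square: "blade_sign A B * blade_sign A B = 1"
  unfolding blade_sign_def prod.distrib[symmetric] by (intro prod.neutral ballI) auto

lemma blade_sign_sym_diff_left:
  "blade_sign (sym_diff A B) C = blade_sign A C * blade_sign B C"
proof -
  have "(\<Prod>b\<in>C. if coord_number b \<le> coord_number a then - 1 else 1) *
        (\<Prod>b\<in>C. if coord_number b \<le> coord_number a then - 1 else 1 :: real) = 1"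
    for a :: "'a \<times> bool"
    unfolding prod.distrib[symmetric] by (intro prod.neutral ballI) auto
  then show ?thesis
    unfolding blade_sign_def by (intro prod_sym_diff_sign) auto
qed

lemma blade_sign_sym_diff_right:
  "blade_sign A (sym_diff B C) = blade_sign A B * blade_sign A C"
proof -
  have "blade_sign A (sym_diff B C) =
    (\<Prod>a\<in>A. (\<Prod>b\<in>B. if coord_number b \<le> coord_number a then - 1 else 1) *
             (\<Prod>b\<in>C. if coord_number b \<le> coord_number a then - 1 else 1))"
    unfolding blade_sign_def
    by (intro prod.cong refl prod_sym_diff_sign) auto
  then show ?thesis unfolding blade_sign_def by (simp add: prod.distrib)
qed

lemma blade_sign_empty [simp]: "blade_sign {} B = 1" "blade_sign A {} = 1"
  by (simp_all add: blade_sign_def)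

instantiation clifford :: (type) real_vector
begin

lift_definition zero_clifford :: "'a clifford" is "\<lambda>_. 0" .
lift_definition plus_clifford :: "'a clifford \<Rightarrow> 'a clifford \<Rightarrow> 'a clifford"
  is "\<lambda>x y A. x A + y A" .
lift_definition minus_clifford :: "'a clifford \<Rightarrow> 'a clifford \<Rightarrow> 'a clifford"
  is "\<lambda>x y A. x A - y A" .
lift_definition uminus_clifford :: "'a clifford \<Rightarrow> 'a clifford" is "\<lambda>x A. - x A" .
lift_definition scaleR_clifford :: "real \<Rightarrow> 'a clifford \<Rightarrow> 'a clifford" is "\<lambda>r x A. r * x A" .

instance
  by standard (transfer; auto simp: algebra_simps)+

end

instantiation clifford :: ("{finite,linorder}") real_algebra_1
begin

lift_definition one_clifford :: "'a clifford" is "\<lambda>A. if A = {} then 1 else 0" .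
lift_definition times_clifford :: "'a clifford \<Rightarrow> 'a clifford \<Rightarrow> 'a clifford"
  is "\<lambda>x y C. \<Sum>A\<in>UNIV. blade_sign A (sym_diff A C) * x A * y (sym_diff A C)" .

instance
proof
  fix x y z :: "'a clifford" and r :: real
  show "x * y * z = x * (y * z)"
  proof (rule clifford_eqI)
    fix D :: "('a \<times> bool) set"
    have dd: "sym_diff A (sym_diff A B) = B" for A B :: "('a \<times> bool) set" by blast
    have "cl_coeff (x * y * z) D = (\<Sum>C\<in>UNIV. \<Sum>A\<in>UNIV. blade_sign C (sym_diff C D) *
        (blade_sign A (sym_diff A C) * cl_coeff x A * cl_coeff y (sym_diff A C)) *
        cl_coeff z (sym_diff C D))"
      by (simp add: times_clifford.rep_eq sum_distrib_left sum_distrib_right)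
    also have "\<dots> = (\<Sum>A\<in>UNIV. \<Sum>C\<in>UNIV. blade_sign C (sym_diff C D) *
        (blade_sign A (sym_diff A C) * cl_coeff x A * cl_coeff y (sym_diff A C)) *
        cl_coeff z (sym_diff C D))"
      by (rule sum.swap)
    also have "\<dots> = (\<Sum>A\<in>UNIV. \<Sum>B\<in>UNIV. blade_sign A (sym_diff A D) * cl_coeff x A *
        (blade_sign B (sym_diff B (sym_diff A D)) * cl_coeff y B *
         cl_coeff z (sym_diff B (sym_diff A D))))"
    proof (rule sum.cong[OF refl])
      fix A :: "('a \<times> bool) set"
      have "(\<Sum>C\<in>UNIV. blade_sign C (sym_diff C D) *
          (blade_sign A (sym_diff A C) * cl_coeff x A * cl_coeff y (sym_diff A C)) *
          cl_coeff z (sym_diff C D)) =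
        (\<Sum>B\<in>UNIV. blade_sign (sym_diff A B) (sym_diff (sym_diff A B) D) *
          (blade_sign A B * cl_coeff x A * cl_coeff y B) *
          cl_coeff z (sym_diff (sym_diff A B) D))"
        by (rule sum.reindex_bij_witness[where i="sym_diff A" and j="sym_diff A"])
           (simp_all only: dd UNIV_I)
      also have "\<dots> = (\<Sum>B\<in>UNIV. blade_sign A (sym_diff A D) * cl_coeff x A *
        (blade_sign B (sym_diff B (sym_diff A D)) * cl_coeff y B *
         cl_coeff z (sym_diff B (sym_diff A D))))"
      proof (rule sum.cong[OF refl])
        fix B :: "('a \<times> bool) set"
        let ?R = "sym_diff B (sym_diff A D)"
        have R: "sym_diff (sym_diff A B) D = ?R" by blast
        have AD: "sym_diff A D = sym_diff B ?R" by blast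
        have "blade_sign (sym_diff A B) ?R * blade_sign A B
            = blade_sign A (sym_diff B ?R) * blade_sign B ?R"
          unfolding blade_sign_sym_diff_left[of A B] blade_sign_sym_diff_right[of A B] by simp
        then show "blade_sign (sym_diff A B) (sym_diff (sym_diff A B) D) *
          (blade_sign A B * cl_coeff x A * cl_coeff y B) *
          cl_coeff z (sym_diff (sym_diff A B) D) =
          blade_sign A (sym_diff A D) * cl_coeff x A *
          (blade_sign B ?R * cl_coeff y B * cl_coeff z ?R)"
          unfolding R AD[symmetric] by (simp add: algebra_simps)
      qed
      finally show "(\<Sum>C\<in>UNIV. blade_sign C (sym_diff C D) *
          (blade_sign A (sym_diff A C) * cl_coeff x A * cl_coeff y (sym_diff A C)) *
          cl_coeff z (sym_diff C D)) = \<dots>" .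
    qed
    also have "\<dots> = cl_coeff (x * (y * z)) D"
      by (simp add: times_clifford.rep_eq sum_distrib_left sum_distrib_right)
    finally show "cl_coeff (x * y * z) D = cl_coeff (x * (y * z)) D" .
  qed
  show "1 * x = x"
    by (rule clifford_eqI)
       (simp add: times_clifford.rep_eq one_clifford.rep_eq if_distrib if_distribR cong: if_cong)
  show "x * 1 = x"
  proof (rule clifford_eqI)
    fix C
    have "cl_coeff (x * 1) C = (\<Sum>A\<in>UNIV. if A = C then cl_coeff x A else 0)"
      unfolding times_clifford.rep_eq one_clifford.rep_eq by (intro sum.cong) auto
    then show "cl_coeff (x * 1) C = cl_coeff x C" by simp
  qed
  show "(x + y) * z = x * z + y * z" "x * (y + z) = x * y + x * z"
    by (rule clifford_eqI,
        simp add: times_clifford.rep_eq plus_clifford.rep_eq algebra_simps sum.distrib)+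
  show "r *\<^sub>R x * y = r *\<^sub>R (x * y)" "x * r *\<^sub>R y = r *\<^sub>R (x * y)"
    by (rule clifford_eqI,
        simp add: times_clifford.rep_eq scaleR_clifford.rep_eq sum_distrib_left algebra_simps)+
  show "(0 :: 'a clifford) \<noteq> 1"
    by transfer (auto dest: fun_cong[of _ _ "{}"])
qed

end

lift_definition cl_basis :: "'m \<times> bool \<Rightarrow> 'm clifford" is "\<lambda>i A. if A = {i} then 1 else 0" .

lemma coord_number_inj: "coord_number i = coord_number j \<longleftrightarrow> i = j"
proof -
  have mono: "card {k. k < a} < card {k. k < b}" if "a < b" for a b :: 'a
    using that by (intro psubset_card_mono) auto
  have "fst i = fst j \<and> snd i = snd j" if "coord_number i = coord_number j"
  proof -
    have c: "card {k. k < fst i} = card {k. k < fst j}" and "snd i = snd j"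
      using that unfolding coord_number_def by (auto split: if_splits) presburger+
    then show ?thesis
      using mono[of "fst i" "fst j"] mono[of "fst j" "fst i"] by (metis less_irrefl neqE)
  qed
  then show ?thesis using prod_eqI by blast
qed

lemma cl_basis_mult:
  "cl_coeff (cl_basis i * cl_basis j) C = (if C = sym_diff {i} {j} then blade_sign {i} {j} else 0)"
proof -
  have "cl_coeff (cl_basis i * cl_basis j) C =
      (\<Sum>A\<in>UNIV. if A = {i} then (if C = sym_diff {i} {j} then blade_sign {i} {j} else 0) else 0)"
    unfolding times_clifford.rep_eq cl_basis.rep_eq
  proof (rule sum.cong[OF refl])
    fix A :: "('a \<times> bool) set"
    have "sym_diff {i} C = {j} \<longleftrightarrow> C = sym_diff {i} {j}" by blast
    then show "blade_sign A (sym_diff A C) * (if A = {i} then 1 else 0) *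
        (if sym_diff A C = {j} then 1 else 0) =
      (if A = {i} then if C = sym_diff {i} {j} then blade_sign {i} {j} else 0 else 0)"
      by (cases "A = {i}") auto
  qed
  then show ?thesis by simp
qed

lemma cl_basis_square: "cl_basis i * cl_basis i = -1"
  by (rule clifford_eqI)
     (simp add: cl_basis_mult uminus_clifford.rep_eq one_clifford.rep_eq blade_sign_def)

lemma cl_basis_anticommute: "i \<noteq> j \<Longrightarrow> cl_basis i * cl_basis j = - (cl_basis j * cl_basis i)"
  by (rule clifford_eqI)
     (use coord_number_inj[of i j] in
       \<open>auto simp: cl_basis_mult uminus_clifford.rep_eq blade_sign_def\<close>)

definition cl_vector :: "real ^ ('m::{finite,linorder} \<times> bool) \<Rightarrow> 'm clifford" where
  "cl_vector v = (\<Sum>i\<in>UNIV. (v $ i) *\<^sub>R cl_basis i)"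

text \<open>The automorphism that is \<open>-1\<close> on vectors.\<close>

lift_definition cl_grade :: "'m clifford \<Rightarrow> 'm clifford" is "\<lambda>x A. (-1) ^ card A * x A" .

definition cl_inverse :: "'m::{finite,linorder} clifford \<Rightarrow> 'm clifford" where
  "cl_inverse x = (THE y. x * y = 1 \<and> y * x = 1)"

definition Pin :: "'m::{finite,linorder} clifford set" where
  "Pin = {prod_list (map cl_vector vs) | vs. \<forall>v\<in>set vs. norm v = 1}"

text \<open>
  The twisted adjoint representation, which sends a unit vector to the reflection in its
  orthogonal complement. The untwisted one differs from it by the factor \<open>det\<close>; since \<open>2m\<close> is
  even, it has the same image, and passing to it multiplies the lifts of orientation-reversing
  maps by the volume element, which commutes with the even elements.
\<close>

definition pin_lift ::
  "'m::{finite,linorder} clifford \<Rightarrow> (real ^ ('m \<times> bool) \<Rightarrow> real ^ ('m \<times> bool)) \<Rightarrow> bool" where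
  "pin_lift x \<Psi> \<longleftrightarrow>
     x \<in> Pin \<and> (\<forall>v. cl_grade x * cl_vector v * cl_inverse x = cl_vector (\<Psi> v))"


section \<open>Lens spaces and their isometries\<close>

definition block_rotation ::
  "(real ^ 'm::finite) \<Rightarrow> real ^ ('m \<times> bool) \<Rightarrow> real ^ ('m \<times> bool)" where
  "block_rotation \<theta> x = (\<chi> i. case i of (j, b) \<Rightarrow>
     if b then sin (\<theta> $ j) * x $ (j, False) + cos (\<theta> $ j) * x $ (j, True)
     else cos (\<theta> $ j) * x $ (j, False) - sin (\<theta> $ j) * x $ (j, True))"

definition lens_generator ::
  "nat \<Rightarrow> int ^ 'm::finite \<Rightarrow> real ^ ('m \<times> bool) \<Rightarrow> real ^ ('m \<times> bool)" where
  "lens_generator q s = block_rotation (\<chi> j. 2 * pi * real_of_int (s $ j) / real q)"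

text \<open>The generator has finite order, so its natural powers form the group it generates.\<close>

definition lens_group ::
  "nat \<Rightarrow> int ^ 'm::finite \<Rightarrow> (real ^ ('m \<times> bool) \<Rightarrow> real ^ ('m \<times> bool)) set" where
  "lens_group q s = range (\<lambda>k. lens_generator q s ^^ k)"

definition lens_orbit ::
  "nat \<Rightarrow> int ^ 'm::finite \<Rightarrow> real ^ ('m \<times> bool) \<Rightarrow> (real ^ ('m \<times> bool)) set" where
  "lens_orbit q s x = {g x | g. g \<in> lens_group q s}"

definition lens_space :: "nat \<Rightarrow> int ^ 'm::finite \<Rightarrow> (real ^ ('m \<times> bool)) set set" where
  "lens_space q s = lens_orbit q s ` sphere 0 1"

text \<open>
  The Riemannian distance of the quotient of the round sphere: \<open>arccos (x \<bullet> y)\<close> is the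
  geodesic distance on the sphere.
\<close>

definition lens_dist :: "(real ^ 'n::finite) set \<Rightarrow> (real ^ 'n) set \<Rightarrow> real" where
  "lens_dist X Y = Inf {arccos (x \<bullet> y) | x y. x \<in> X \<and> y \<in> Y}"

text \<open>By the Myers-Steenrod theorem these are exactly the Riemannian isometries.\<close>

definition lens_isometry ::
  "nat \<Rightarrow> int ^ 'm::finite \<Rightarrow> int ^ 'm \<Rightarrow>
     ((real ^ ('m \<times> bool)) set \<Rightarrow> (real ^ ('m \<times> bool)) set) \<Rightarrow> bool" where
  "lens_isometry q s s' \<psi> \<longleftrightarrow>
     bij_betw \<psi> (lens_space q s) (lens_space q s') \<and>
     (\<forall>X\<in>lens_space q s. \<forall>Y\<in>lens_space q s. lens_dist (\<psi> X) (\<psi> Y) = lens_dist X Y)"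

definition lens_lift ::
  "nat \<Rightarrow> int ^ 'm::finite \<Rightarrow> int ^ 'm \<Rightarrow>
     ((real ^ ('m \<times> bool)) set \<Rightarrow> (real ^ ('m \<times> bool)) set) \<Rightarrow>
     (real ^ ('m \<times> bool) \<Rightarrow> real ^ ('m \<times> bool)) \<Rightarrow> bool" where
  "lens_lift q s s' \<psi> \<Psi> \<longleftrightarrow>
     orthogonal_transformation \<Psi> \<and>
     (\<lambda>g. \<Psi> \<circ> g \<circ> inv \<Psi>) ` lens_group q s = lens_group q s' \<and>
     (\<forall>x\<in>sphere 0 1. \<psi> (lens_orbit q s x) = lens_orbit q s' (\<Psi> x))"

text \<open>
  The projections from the oriented sphere preserve orientation, so \<open>\<psi>\<close> preserves or reverses
  orientation according to the action of a lift on the orientation of the sphere. Two lifts differ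
  by an element of \<open>lens_group q s'\<close>, hence have the same determinant.
\<close>

definition oriented_lens_isometry ::
  "int \<Rightarrow> nat \<Rightarrow> int ^ 'm::finite \<Rightarrow> int ^ 'm \<Rightarrow>
     ((real ^ ('m \<times> bool)) set \<Rightarrow> (real ^ ('m \<times> bool)) set) \<Rightarrow> bool" where
  "oriented_lens_isometry \<epsilon> q s s' \<psi> \<longleftrightarrow>
     lens_isometry q s s' \<psi> \<and>
     (\<exists>\<Psi>. lens_lift q s s' \<psi> \<Psi> \<and> det (matrix \<Psi>) = of_int \<epsilon>)"


section \<open>Spin structures\<close>

definition floor_sum :: "nat \<Rightarrow> int ^ 'm::finite \<Rightarrow> int" where
  "floor_sum q s = (\<Sum>j\<in>UNIV. \<lfloor>real_of_int (s $ j) / real q\<rfloor>)"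

definition spin_power ::
  "nat \<Rightarrow> int ^ 'm::{finite,linorder} \<Rightarrow> int \<Rightarrow> nat \<Rightarrow> 'm clifford" where
  "spin_power q s h k =
     ((-1) powi (int k * (h + floor_sum q s))) *\<^sub>R
     prod_list (map (\<lambda>j.
         of_real (cos (real k * real_of_int (s $ j) * pi / real q)) +
         of_real (sin (real k * real_of_int (s $ j) * pi / real q)) *
           (cl_basis (j, False) * cl_basis (j, True)))
       (sorted_list_of_set UNIV))"

text \<open>
  For \<open>q\<close> and \<open>m\<close> even, the choice of the exponent is irrelevant; see \<open>spin_structure_power\<close>.
\<close>

definition spin_structure ::
  "nat \<Rightarrow> int ^ 'm::{finite,linorder} \<Rightarrow> int \<Rightarrow>
     (real ^ ('m \<times> bool) \<Rightarrow> real ^ ('m \<times> bool)) \<Rightarrow> 'm clifford" where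
  "spin_structure q s h g = spin_power q s h (LEAST k. g = lens_generator q s ^^ k)"

definition takes_spin_structure ::
  "nat \<Rightarrow> int ^ 'm::{finite,linorder} \<Rightarrow> int ^ 'm::{finite,linorder} \<Rightarrow>
     ((real ^ ('m \<times> bool)) set \<Rightarrow> (real ^ ('m \<times> bool)) set) \<Rightarrow>
     ((real ^ ('m \<times> bool) \<Rightarrow> real ^ ('m \<times> bool)) \<Rightarrow> 'm clifford) \<Rightarrow>
     ((real ^ ('m \<times> bool) \<Rightarrow> real ^ ('m \<times> bool)) \<Rightarrow> 'm clifford) \<Rightarrow> bool" where
  "takes_spin_structure q s s' \<psi> \<tau> \<tau>' \<longleftrightarrow>
     (\<exists>\<Psi> x. lens_lift q s s' \<psi> \<Psi> \<and> pin_lift x \<Psi> \<and>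
       (\<forall>g\<in>lens_group q s. \<tau>' (\<Psi> \<circ> g \<circ> inv \<Psi>) = x * \<tau> g * cl_inverse x))"

lemma block_rotation_power:
  "(block_rotation \<theta> ^^ k) x = block_rotation (of_nat k *\<^sub>R \<theta>) x"
proof (induction k)
  case 0
  show ?case by (auto simp: block_rotation_def vec_eq_iff)
next
  case (Suc k)
  then show ?case
    by (auto simp: block_rotation_def vec_eq_iff distrib_right cos_add sin_add algebra_simps)
qed

lemma block_rotation_eqD:
  assumes "block_rotation \<theta> = block_rotation \<theta>'"
  shows "cos (\<theta> $ j) = cos (\<theta>' $ j)" "sin (\<theta> $ j) = sin (\<theta>' $ j)"
proof -
  have "block_rotation \<theta> (axis (j, False) 1) $ (j, b)
      = block_rotation \<theta>' (axis (j, False) 1) $ (j, b)" for b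
    using assms by simp
  from this[of False] this[of True] show "cos (\<theta> $ j) = cos (\<theta>' $ j)" "sin (\<theta> $ j) = sin (\<theta>' $ j)"
    by (simp_all add: block_rotation_def axis_def)
qed

lemma prod_list_map_uminus:
  fixes f :: "'a \<Rightarrow> 'b::ring_1"
  shows "prod_list (map (\<lambda>j. - f j) xs) = (-1) ^ length xs * prod_list (map f xs)"
proof (induction xs)
  case (Cons x xs)
  then show ?case by (cases "even (length xs)") simp_all
qed simp

lemma spin_power_add_q:
  fixes s :: "int ^ 'm::{finite,linorder}"
  assumes q: "q > 0" "even q" and m: "even CARD('m)" and s: "\<And>j. coprime (s $ j) (int q)"
  shows "spin_power q s h (k + q) = spin_power q s h k"
proof -
  have odd: "odd (s $ j)" for j
    using s[of j] q(2) by (metis coprime_common_divisor even_of_nat odd_one)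
  have arg: "real (k + q) * real_of_int (s $ j) * pi / real q
      = real k * real_of_int (s $ j) * pi / real q + real_of_int (s $ j) * pi" for j
    using q(1) by (simp add: field_simps)
  have cs: "cos (real (k + q) * real_of_int (s $ j) * pi / real q)
        = - cos (real k * real_of_int (s $ j) * pi / real q)"
      "sin (real (k + q) * real_of_int (s $ j) * pi / real q)
        = - sin (real k * real_of_int (s $ j) * pi / real q)" for j
  proof -
    have "cos (real_of_int (s $ j) * pi) = -1" "sin (real_of_int (s $ j) * pi) = 0"
      using odd[of j] by (simp_all add: mult.commute[of _ pi] cos_npi_int sin_npi_int)
    then show "cos (real (k + q) * real_of_int (s $ j) * pi / real q)
        = - cos (real k * real_of_int (s $ j) * pi / real q)"
      "sin (real (k + q) * real_of_int (s $ j) * pi / real q)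
        = - sin (real k * real_of_int (s $ j) * pi / real q)"
      unfolding arg by (simp_all add: cos_add sin_add)
  qed
  let ?f = "\<lambda>j::'m. of_real (cos (real k * real_of_int (s $ j) * pi / real q)) +
         of_real (sin (real k * real_of_int (s $ j) * pi / real q)) *
           (cl_basis (j, False) * cl_basis (j, True))"
  have f: "(\<lambda>j::'m. of_real (cos (real (k + q) * real_of_int (s $ j) * pi / real q)) +
         of_real (sin (real (k + q) * real_of_int (s $ j) * pi / real q)) *
           (cl_basis (j, False) * cl_basis (j, True))) = (\<lambda>j. - ?f j)"
    unfolding cs by (simp add: fun_eq_iff)
  have "(-1 :: real) powi (int (k + q) * (h + floor_sum q s))
      = (-1) powi (int k * (h + floor_sum q s))"
    using q(2) by (simp add: power_int_add distrib_right power_int_minus_left)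
  then show ?thesis
    unfolding spin_power_def f prod_list_map_uminus using m by simp
qed

lemma spin_structure_power:
  fixes s :: "int ^ 'm::{finite,linorder}"
  assumes q: "q > 0" "even q" and m: "even CARD('m)" and s: "\<And>j. coprime (s $ j) (int q)"
  shows "spin_structure q s h (lens_generator q s ^^ k) = spin_power q s h k"
proof -
  define l where "l = (LEAST l. lens_generator q s ^^ k = lens_generator q s ^^ l)"
  have l: "lens_generator q s ^^ k = lens_generator q s ^^ l"
    unfolding l_def by (rule LeastI[of _ k]) simp
  have "l \<le> k" unfolding l_def by (rule Least_le) simp
  fix j :: 'm
  define a where "a i = real i * (2 * pi * real_of_int (s $ j) / real q)" for i :: nat
  have eq: "block_rotation (of_nat k *\<^sub>R (\<chi> j. 2 * pi * real_of_int (s $ j) / real q))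
      = block_rotation (of_nat l *\<^sub>R (\<chi> j. 2 * pi * real_of_int (s $ j) / real q))"
    using l unfolding lens_generator_def by (simp add: fun_eq_iff block_rotation_power)
  have "cos (a k) = cos (a l)" "sin (a k) = sin (a l)"
    using block_rotation_eqD[OF eq, of j] by (simp_all add: a_def)
  then obtain n :: int where "a k = a l + 2 * pi * n"
    using sin_cos_eq_iff[of "a k" "a l"] by (auto simp: mult.commute)
  then have "real k * real_of_int (s $ j) = real l * real_of_int (s $ j) + real q * n"
  proof -
    have "pi * (real k * real_of_int (s $ j)) = pi * (real l * real_of_int (s $ j) + real q * n)"
      using \<open>a k = a l + 2 * pi * n\<close> q(1) by (simp add: a_def field_simps)
    then show ?thesis by simp
  qed
  then have "real_of_int (int k * s $ j) = real_of_int (int l * s $ j + int q * n)"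
    by simp
  then have "(int k - int l) * s $ j = int q * n"
    by (simp only: of_int_eq_iff) (simp add: algebra_simps)
  then have "int q dvd (int k - int l) * s $ j" by simp
  then have "int q dvd int k - int l"
    using s[of j] by (simp add: coprime_dvd_mult_left_iff coprime_commute)
  then have "q dvd k - l"
    using \<open>l \<le> k\<close> by (metis int_dvd_int_iff of_nat_diff)
  then obtain i where i: "k = l + q * i"
    using \<open>l \<le> k\<close> by (metis dvdE le_add_diff_inverse)
  have "spin_power q s h (l + q * i) = spin_power q s h l" for i
  proof (induction i)
    case (Suc i)
    then show ?case
      using spin_power_add_q[OF assms, of h "l + q * i"] by (simp add: algebra_simps)
  qed simp
  then have "spin_power q s h k = spin_power q s h l" unfolding i .
  then show ?thesis
    unfolding spin_structure_def l_def[symmetric] by simp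
qed


section \<open>Lattices\<close>

definition half_odd_vectors :: "(real ^ 'm::finite) set" where
  "half_odd_vectors = {(\<chi> j. real_of_int (a $ j) / 2) | a :: int ^ 'm. \<forall>j. odd (a $ j)}"

definition lens_lattice :: "nat \<Rightarrow> int ^ 'm::finite \<Rightarrow> (real ^ 'm) set" where
  "lens_lattice q s = {(\<chi> j. real_of_int (a $ j) / 2) | a :: int ^ 'm.
     (\<forall>j. odd (a $ j)) \<and> [(\<Sum>j\<in>UNIV. a $ j * s $ j) = 0] (mod int q)}"

definition spin_lattice :: "nat \<Rightarrow> int ^ 'm::finite \<Rightarrow> int \<Rightarrow> (real ^ 'm) set" where
  "spin_lattice q s h = {(\<chi> j. real_of_int (a $ j) / 2) | a :: int ^ 'm.
     (\<forall>j. odd (a $ j)) \<and> [(\<Sum>j\<in>UNIV. a $ j * s $ j) = h * int q] (mod (2 * int q))}"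

text \<open>
  \<open>spin_structure q s h\<close> depends only on \<open>h\<close> and on the residues of \<open>s\<close> modulo \<open>q\<close>, because of the
  term \<open>floor_sum q s\<close>, whereas adding \<open>q\<close> to one coordinate of \<open>s\<close> interchanges
  \<open>spin_lattice q s 0\<close> and \<open>spin_lattice q s 1\<close>. The lattice that belongs to
  \<open>spin_structure q s h\<close> is therefore \<open>spin_lattice q s (h + floor_sum q s)\<close>; it is
  \<open>spin_lattice q s h\<close> if all coordinates of \<open>s\<close> lie in \<open>{0..<q}\<close>.
\<close>

text \<open>
  A map on \<open>half_odd_vectors\<close>; its values elsewhere play no role.
\<close>

definition oriented_l1_isometry :: "int \<Rightarrow> (real ^ 'm::finite \<Rightarrow> real ^ 'm) \<Rightarrow> bool" where
  "oriented_l1_isometry \<epsilon> \<phi> \<longleftrightarrow>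
     (\<exists>(\<sigma> :: 'm \<Rightarrow> 'm) (e :: 'm \<Rightarrow> int).
        bij \<sigma> \<and> (\<forall>j. e j \<in> {-1, 1}) \<and> (\<Prod>j\<in>UNIV. e j) = \<epsilon> \<and>
        (\<forall>x\<in>half_odd_vectors. \<phi> x = (\<chi> i. of_int (e (inv \<sigma> i)) * x $ inv \<sigma> i)))"

end

theory Submission
  imports Defs
begin

text \<open>
  Conjugation by an orthogonal map intertwines the generator of \<open>\<Gamma>\<close> with a power of that of \<open>\<Gamma>'\<close>,
  so comparing eigenvalues gives a permutation \<open>\<sigma>\<close>, signs \<open>e\<close> and integers \<open>n\<close> with
  \<open>e\<^sub>j s\<^sub>j = k s'\<^bsub>\<sigma> j\<^esub> + q n\<^sub>j\<close>; such a relation is also what a signed permutation between the lattices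
  amounts to. The determinant and the spin structures are read off in the Clifford algebra. The lifts
  of the two generators are rotors \<open>\<Prod>\<^sub>j (cos \<theta>\<^sub>j + sin \<theta>\<^sub>j e\<^bsub>2j-1\<^esub> e\<^bsub>2j\<^esub>)\<close>, and conjugation by a lift
  of the orthogonal map carries one to a multiple \<open>\<delta>\<close> of the other. Conjugation preserves the
  scalar part, the product of the cosines, and multiplies the top-degree part, up to sign the
  product of the sines, by the determinant. Comparing these parts expresses \<open>\<delta>\<close> and the
  determinant through \<open>e\<close> and the parity of \<open>\<Sum>\<^sub>j n\<^sub>j\<close>. For \<open>q \<le> 2\<close> the cosines or sines may vanish,
  but then the signs can be chosen freely.
\<close>

section \<open>Rotors in the Clifford algebra\<close>

text \<open>When rotation angles coincide, the orthogonal map need not permute the coordinate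
  planes, so the signs \<open>e\<close> cannot be read off it directly. What survives is invariant
  under conjugation: the multiset of cosines, which gives \<open>\<sigma>\<close>, and two traces in
  the Clifford algebra. The congruence of the angles is kept as an equation with explicit integers
  \<open>n\<close>: modulo \<open>q\<close> they disappear, but half angles see their parity, and so
  do the lattices modulo \<open>2 * q\<close>. This common dependence on the parity of their sum
  ties spin structures to lattices.

  Two further points shape the proof. Orientation and spin structure are each stated with a lift of
  their own, so all lifts of one isometry must have the same determinant. And a lattice reveals the
  multiplier \<open>k\<close> only if it contains a point to move from; for even \<open>q\<close>
  this requires \<open>m\<close> to be even, since a sum of \<open>m\<close> odd products has to be
  divisible by \<open>q\<close>.\<close>

definition cl_scalar :: "'m clifford \<Rightarrow> real" where
  "cl_scalar x = cl_coeff x {}"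

lemma cl_scalar_linear:
  "cl_scalar (x + y) = cl_scalar x + cl_scalar y"
  "cl_scalar (r *\<^sub>R x) = r * cl_scalar x"
  "cl_scalar (- x) = - cl_scalar x"
  "cl_scalar (1 :: 'm::{finite,linorder} clifford) = 1"
  by (simp_all add: cl_scalar_def plus_clifford.rep_eq scaleR_clifford.rep_eq
      uminus_clifford.rep_eq one_clifford.rep_eq)

text \<open>The trace property: up to a factor \<open>cl_scalar\<close> is the trace of left
  multiplication, because multiplication by a nonempty blade moves every blade. It makes the scalar
  part invariant under conjugation.\<close>

lemma cl_scalar_commute: "cl_scalar (x * y) = cl_scalar (y * x)"
  by (simp add: cl_scalar_def times_clifford.rep_eq mult_ac)

lemma cl_coeff_basis_mult:
  "cl_coeff (cl_basis i * z) C = blade_sign {i} (sym_diff {i} C) * cl_coeff z (sym_diff {i} C)"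
proof -
  have "cl_coeff (cl_basis i * z) C = (\<Sum>A\<in>UNIV. if A = {i}
      then blade_sign {i} (sym_diff {i} C) * cl_coeff z (sym_diff {i} C) else 0)"
    unfolding times_clifford.rep_eq cl_basis.rep_eq by (intro sum.cong) auto
  then show ?thesis by simp
qed

lemma cl_coeff_mult_basis:
  "cl_coeff (z * cl_basis i) C = blade_sign (sym_diff {i} C) {i} * cl_coeff z (sym_diff {i} C)"
proof -
  have "cl_coeff (z * cl_basis i) C = (\<Sum>A\<in>UNIV. if A = sym_diff {i} C
      then blade_sign (sym_diff {i} C) {i} * cl_coeff z (sym_diff {i} C) else 0)"
    unfolding times_clifford.rep_eq cl_basis.rep_eq
  proof (rule sum.cong[OF refl])
    fix A :: "('a \<times> bool) set"
    have "sym_diff A C = {i} \<longleftrightarrow> A = sym_diff {i} C" by blast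
    moreover have "sym_diff (sym_diff {i} C) C = {i}" by blast
    ultimately show "blade_sign A (sym_diff A C) * cl_coeff z A *
        (if sym_diff A C = {i} then 1 else 0) =
      (if A = sym_diff {i} C
       then blade_sign (sym_diff {i} C) {i} * cl_coeff z (sym_diff {i} C) else 0)"
      by simp
  qed
  then show ?thesis by simp
qed

text \<open>For \<open>b\<close> in \<open>A\<close> other than \<open>i\<close> exactly one of the
  two orderings contributes a sign; for \<open>b = i\<close> both do, and they cancel.\<close>

lemma blade_sign_singleton_swap:
  "blade_sign {i} A * blade_sign A {i} = (-1) ^ card (A - {i})"
proof -
  have "blade_sign {i} A * blade_sign A {i} =
      (\<Prod>b\<in>A. if b \<in> A - {i} then -1 else 1)"
    unfolding blade_sign_def prod.distrib[symmetric]
    by (simp add: prod.distrib[symmetric] if_distrib if_distribR, intro prod.cong refl)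
       (use coord_number_inj[of _ i] in \<open>auto simp: not_le dest: order.antisym\<close>)
  also have "\<dots> = (\<Prod>b\<in>A - {i}. -1)"
    by (rule prod.mono_neutral_cong_right) auto
  finally show ?thesis by simp
qed

text \<open>The number \<open>2m\<close> of generators is even, so no blade other than \<open>1\<close> is central.\<close>

lemma clifford_centre:
  fixes z :: "'m::{finite,linorder} clifford"
  assumes "\<And>i. cl_basis i * z = z * cl_basis i"
  shows "z = cl_scalar z *\<^sub>R 1"
proof (rule clifford_eqI)
  fix A :: "('m \<times> bool) set"
  have "cl_coeff z A = 0" if "A \<noteq> {}"
  proof -
    \<comment> \<open>The basis vector of such an \<open>i\<close> anticommutes with the blade of
      \<open>A\<close>. It is found inside \<open>A\<close> if \<open>card A\<close> is even and
      outside if it is odd.\<close>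
    have "\<exists>i. odd (card (A - {i}))"
    proof (cases "even (card A)")
      case True
      from that obtain i where i: "i \<in> A" by blast
      moreover from i have "card A > 0" by (auto simp: card_gt_0_iff)
      ultimately show ?thesis using True by (intro exI[of _ i]) (use i in \<open>auto simp: card_Diff_singleton\<close>)
    next
      case False
      have "even (card (UNIV :: ('m \<times> bool) set))" by simp
      with False have "A \<noteq> UNIV" by metis
      then show ?thesis using False by (metis Diff_empty Diff_insert0 UNIV_eq_I)
    qed
    then obtain i where i: "odd (card (A - {i}))" by blast
    have A: "sym_diff {i} (sym_diff {i} A) = A" by blast
    have "blade_sign {i} A * cl_coeff z A = blade_sign A {i} * cl_coeff z A"
      using arg_cong[OF assms[of i], of "\<lambda>x. cl_coeff x (sym_diff {i} A)"]
      unfolding cl_coeff_basis_mult cl_coeff_mult_basis A .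
    moreover have "blade_sign {i} A * blade_sign A {i} = -1"
      using i by (simp add: blade_sign_singleton_swap)
    ultimately show ?thesis
      using blade_sign_square[of A "{i}"] by (auto simp: mult_eq_0_iff)
  qed
  then show "cl_coeff z A = cl_coeff (cl_scalar z *\<^sub>R 1) A"
    by (auto simp: cl_scalar_def scaleR_clifford.rep_eq one_clifford.rep_eq)
qed

section \<open>Vectors and the Clifford relation\<close>

lemma cl_vector_linear: "linear cl_vector"
  by (rule linearI)
     (simp_all add: cl_vector_def scaleR_left.add sum.distrib scaleR_sum_right)

lemmas cl_vector_add = linear_add[OF cl_vector_linear]
  and cl_vector_diff = linear_diff[OF cl_vector_linear]
  and cl_vector_neg = linear_neg[OF cl_vector_linear]
  and cl_vector_scaleR = linear_scale[OF cl_vector_linear]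

lemma cl_coeff_sum: "cl_coeff (sum f S) A = (\<Sum>i\<in>S. cl_coeff (f i) A)"
  by (induction S rule: infinite_finite_induct) (simp_all add: zero_clifford.rep_eq plus_clifford.rep_eq)

lemma cl_coeff_vector: "cl_coeff (cl_vector v) A = (\<Sum>i\<in>UNIV. if A = {i} then v $ i else 0)"
  unfolding cl_vector_def cl_coeff_sum
  by (intro sum.cong) (simp_all add: scaleR_clifford.rep_eq cl_basis.rep_eq)

lemma cl_coeff_vector_singleton: "cl_coeff (cl_vector v) {i} = v $ i"
  by (simp add: cl_coeff_vector)

lemma cl_vector_inject: "cl_vector v = cl_vector w \<longleftrightarrow> v = w"
  by (metis cl_coeff_vector_singleton vec_eq_iff)

lemma cl_vector_axis: "cl_vector (axis i 1) = cl_basis i"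
  unfolding cl_vector_def axis_def by (simp add: if_distrib if_distribR cong: if_cong)

lemma cl_basis_anticommutator:
  "cl_basis i * cl_basis j + cl_basis j * cl_basis i = (if i = j then (-2) *\<^sub>R 1 else 0)"
  using cl_basis_anticommute[of i j] cl_basis_square[of i]
  by (auto simp only: scaleR_minus_left scaleR_2 minus_add_distrib split: if_splits) auto

lemma cl_vector_anticommutator:
  "cl_vector v * cl_vector w + cl_vector w * cl_vector v = - (2 * (v \<bullet> w)) *\<^sub>R 1"
proof -
  have "cl_vector v * cl_vector w + cl_vector w * cl_vector v =
     (\<Sum>i\<in>UNIV. \<Sum>j\<in>UNIV. (v $ i * w $ j) *\<^sub>R (cl_basis i * cl_basis j + cl_basis j * cl_basis i))"
  proof -
    have 1: "cl_vector v * cl_vector w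
        = (\<Sum>i\<in>UNIV. \<Sum>j\<in>UNIV. (v $ i * w $ j) *\<^sub>R (cl_basis i * cl_basis j))"
      by (simp add: cl_vector_def sum_product mult.commute)
    have "cl_vector w * cl_vector v
        = (\<Sum>j\<in>UNIV. \<Sum>i\<in>UNIV. (v $ i * w $ j) *\<^sub>R (cl_basis j * cl_basis i))"
      by (simp add: cl_vector_def sum_product mult.commute)
    also have "\<dots> = (\<Sum>i\<in>UNIV. \<Sum>j\<in>UNIV. (v $ i * w $ j) *\<^sub>R (cl_basis j * cl_basis i))"
      by (rule sum.swap)
    finally show ?thesis unfolding 1 by (simp add: scaleR_add_right sum.distrib)
  qed
  also have "\<dots> = (\<Sum>i\<in>UNIV. (- 2 * (v $ i * w $ i)) *\<^sub>R 1)"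
    unfolding cl_basis_anticommutator
    by (simp add: if_distrib[of "\<lambda>x. _ *\<^sub>R x"] mult.commute cong: if_cong)
  also have "\<dots> = - (2 * (v \<bullet> w)) *\<^sub>R 1"
    unfolding scaleR_left.sum[symmetric] inner_vec_def inner_real_def
    by (simp add: sum_distrib_left sum_negf)
  finally show ?thesis .
qed

lemma cl_vector_unit_square: "norm v = 1 \<Longrightarrow> cl_vector v * cl_vector v = -1"
proof -
  assume "norm v = 1"
  then have "2 *\<^sub>R (cl_vector v * cl_vector v) = 2 *\<^sub>R (-1 :: 'a clifford)"
    using cl_vector_anticommutator[of v v]
    by (simp add: norm_eq_1 scaleR_2)
  then show ?thesis unfolding scaleR_cancel_left by simp
qed

lemma cl_inverseI:
  assumes "x * y = 1" "y * x = 1"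
  shows "cl_inverse x = y"
  unfolding cl_inverse_def
proof (rule the_equality)
  fix z assume "x * z = 1 \<and> z * x = 1"
  then show "z = y" using assms by (metis mult.assoc mult_1 mult_1_right)
qed (use assms in simp)

section \<open>Rotors of the coordinate planes\<close>

definition cl_plane :: "'m \<Rightarrow> 'm::{finite,linorder} clifford" where
  "cl_plane j = cl_basis (j, False) * cl_basis (j, True)"

text \<open>The exponential of \<open>t *\<^sub>R cl_plane j\<close>; in the spin group it covers
  the rotation of the plane through \<open>2 * t\<close>.\<close>

definition plane_rotor :: "real \<Rightarrow> 'm \<Rightarrow> 'm::{finite,linorder} clifford" where
  "plane_rotor t j = of_real (cos t) + of_real (sin t) * cl_plane j"

text \<open>The algebra is not commutative, so the product runs over a list; an arbitrary list also
  makes induction over the planes possible.\<close>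

definition list_rotor :: "'m list \<Rightarrow> real ^ 'm::{finite,linorder} \<Rightarrow> 'm clifford" where
  "list_rotor xs \<theta> = prod_list (map (\<lambda>j. plane_rotor (\<theta> $ j) j) xs)"

definition rotor :: "real ^ 'm::{finite,linorder} \<Rightarrow> 'm clifford" where
  "rotor = list_rotor (sorted_list_of_set UNIV)"

lemma plane_rotor_scaleR: "plane_rotor t j = cos t *\<^sub>R 1 + sin t *\<^sub>R cl_plane j"
  by (simp add: plane_rotor_def scaleR_conv_of_real)

lemma cl_plane_mult_basis:
  "cl_plane j * cl_basis (j, False) = cl_basis (j, True)"
  "cl_plane j * cl_basis (j, True) = - cl_basis (j, False)"
  "cl_basis (j, False) * cl_plane j = - cl_basis (j, True)"
  "cl_basis (j, True) * cl_plane j = cl_basis (j, False)"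
proof -
  have F: "cl_basis (j, False) * (cl_basis (j, False) * x) = - x"
    and T: "cl_basis (j, True) * (cl_basis (j, True) * x) = - x" for x :: "'a clifford"
    by (simp_all add: mult.assoc[symmetric] cl_basis_square)
  have TF: "cl_basis (j, True) * cl_basis (j, False) = - (cl_basis (j, False) * cl_basis (j, True))"
    by (rule cl_basis_anticommute) simp
  show "cl_plane j * cl_basis (j, False) = cl_basis (j, True)"
    "cl_plane j * cl_basis (j, True) = - cl_basis (j, False)"
    "cl_basis (j, False) * cl_plane j = - cl_basis (j, True)"
    by (simp_all add: cl_plane_def mult.assoc TF F cl_basis_square)
  have "cl_basis (j, True) * cl_plane j
      = - (cl_basis (j, False) * cl_basis (j, True)) * cl_basis (j, True)"
    by (simp only: cl_plane_def TF mult.assoc[symmetric])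
  then show "cl_basis (j, True) * cl_plane j = cl_basis (j, False)"
    by (simp add: mult.assoc cl_basis_square)
qed

text \<open>The vector anticommutes with each of the two factors of \<open>cl_plane j\<close>, and
  the signs cancel.\<close>

lemma cl_plane_commute_basis:
  assumes "k \<noteq> j"
  shows "cl_plane j * cl_basis (k, b) = cl_basis (k, b) * cl_plane j"
proof -
  have *: "cl_basis (j, c) * cl_basis (k, b) = - (cl_basis (k, b) * cl_basis (j, c))" for c
    using assms by (intro cl_basis_anticommute) auto
  have "cl_plane j * cl_basis (k, b) = cl_basis (j, False) * (cl_basis (j, True) * cl_basis (k, b))"
    by (simp add: cl_plane_def mult.assoc)
  also have "\<dots> = - (cl_basis (j, False) * cl_basis (k, b) * cl_basis (j, True))"
    by (subst *) (simp add: mult.assoc)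
  also have "\<dots> = cl_basis (k, b) * cl_plane j"
    unfolding * by (simp add: cl_plane_def mult.assoc)
  finally show ?thesis .
qed

lemma cl_plane_square: "cl_plane j * cl_plane j = -1"
  using cl_plane_mult_basis(1)[of j]
  by (subst (2) cl_plane_def) (simp add: mult.assoc[symmetric] cl_basis_square)

lemma cl_plane_commute: "cl_plane j * cl_plane k = cl_plane k * cl_plane j"
proof (cases "j = k")
  case False
  have "cl_plane j * cl_plane k = cl_basis (k, False) * cl_plane j * cl_basis (k, True)"
    using False by (simp add: cl_plane_def[of k] mult.assoc[symmetric] cl_plane_commute_basis)
  also have "\<dots> = cl_plane k * cl_plane j"
    using False by (simp add: cl_plane_def[of k] mult.assoc cl_plane_commute_basis)
  finally show ?thesis .
qed simp

lemma plane_rotor_commute: "plane_rotor t j * plane_rotor u k = plane_rotor u k * plane_rotor t j"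
  by (simp add: plane_rotor_scaleR algebra_simps cl_plane_commute[of j k])

lemma plane_rotor_add: "plane_rotor t j * plane_rotor u j = plane_rotor (t + u) j"
  by (simp add: plane_rotor_scaleR cos_add sin_add algebra_simps cl_plane_square)

lemma plane_rotor_commute_basis:
  "k \<noteq> j \<Longrightarrow> plane_rotor t j * cl_basis (k, b) = cl_basis (k, b) * plane_rotor t j"
  by (simp add: plane_rotor_scaleR algebra_simps cl_plane_commute_basis)

lemma block_rotation_linear: "linear (block_rotation \<theta>)"
  by (rule linearI) (auto simp: block_rotation_def vec_eq_iff algebra_simps)

lemma block_rotation_add: "block_rotation \<theta> (block_rotation \<theta>' x) = block_rotation (\<theta> + \<theta>') x"
  by (auto simp: block_rotation_def vec_eq_iff cos_add sin_add algebra_simps)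

lemma block_rotation_0 [simp]: "block_rotation 0 x = x"
  by (auto simp: block_rotation_def vec_eq_iff)

text \<open>As an intertwining relation this involves no inverse. By linearity it is tested on the
  axes: those outside the plane commute with the rotor, and inside the plane it is the subtraction
  formula for \<open>2 * t - t\<close>.\<close>

lemma plane_rotor_vector:
  "plane_rotor t j * cl_vector v = cl_vector (block_rotation (axis j (2 * t)) v) * plane_rotor t j"
proof -
  let ?f = "\<lambda>v. plane_rotor t j * cl_vector v"
  let ?g = "\<lambda>v. cl_vector (block_rotation (axis j (2 * t)) v) * plane_rotor t j"
  have "?f = ?g"
  proof (rule linear_eq_stdbasis)
    show "linear ?f" "linear ?g"
      by (rule linearI; simp add: cl_vector_add cl_vector_scaleR algebra_simps
          linear_add[OF block_rotation_linear] linear_scale[OF block_rotation_linear])+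
    fix b :: "real ^ ('a \<times> bool)" assume "b \<in> Basis"
    then obtain k c where b: "b = axis (k, c) 1" by (auto simp: Basis_vec_def)
    consider "k \<noteq> j" | "k = j" "c = False" | "k = j" "c = True" by auto
    then show "?f b = ?g b"
    proof cases
      case 1
      then have "block_rotation (axis j (2 * t)) b = b"
        unfolding b by (auto simp: block_rotation_def axis_def vec_eq_iff)
      then show ?thesis
        using 1 by (simp add: b cl_vector_axis plane_rotor_commute_basis)
    next
      case 2
      then have "block_rotation (axis j (2 * t)) b
          = cos (2 * t) *\<^sub>R axis (j, False) 1 + sin (2 * t) *\<^sub>R axis (j, True) 1"
        unfolding b by (auto simp: block_rotation_def axis_def vec_eq_iff)
      then have g: "?g b = (cos (2 * t) * cos t + sin (2 * t) * sin t) *\<^sub>R cl_basis (j, False)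
          + (sin (2 * t) * cos t - cos (2 * t) * sin t) *\<^sub>R cl_basis (j, True)"
        by (simp add: cl_vector_add cl_vector_scaleR cl_vector_axis plane_rotor_scaleR
            cl_plane_mult_basis algebra_simps)
      have "?f b = cos (2 * t - t) *\<^sub>R cl_basis (j, False) + sin (2 * t - t) *\<^sub>R cl_basis (j, True)"
        using 2 by (simp add: b cl_vector_axis plane_rotor_scaleR cl_plane_mult_basis algebra_simps)
      then show ?thesis unfolding g cos_diff sin_diff by simp
    next
      case 3
      then have r: "block_rotation (axis j (2 * t)) b
          = cos (2 * t) *\<^sub>R axis (j, True) 1 - sin (2 * t) *\<^sub>R axis (j, False) 1"
        unfolding b by (auto simp: block_rotation_def axis_def vec_eq_iff)
      have g: "?g b = (cos (2 * t) * cos t + sin (2 * t) * sin t) *\<^sub>R cl_basis (j, True)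
          - (sin (2 * t) * cos t - cos (2 * t) * sin t) *\<^sub>R cl_basis (j, False)"
        unfolding r by (simp add: cl_vector_diff cl_vector_scaleR cl_vector_axis plane_rotor_scaleR
            cl_plane_mult_basis algebra_simps)
      have "?f b = cos (2 * t - t) *\<^sub>R cl_basis (j, True) - sin (2 * t - t) *\<^sub>R cl_basis (j, False)"
        using 3 by (simp add: b cl_vector_axis plane_rotor_scaleR cl_plane_mult_basis algebra_simps)
      then show ?thesis unfolding g cos_diff sin_diff by simp
    qed
  qed
  then show ?thesis by metis
qed

lemma list_rotor_simps [simp]:
  "list_rotor [] \<theta> = 1"
  "list_rotor (j # xs) \<theta> = plane_rotor (\<theta> $ j) j * list_rotor xs \<theta>"
  by (simp_all add: list_rotor_def)

text \<open>Planes outside the list are not rotated, hence the default angle 0; distinctness keeps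
  an angle from being counted twice.\<close>

lemma list_rotor_vector:
  "distinct xs \<Longrightarrow> list_rotor xs \<theta> * cl_vector v =
     cl_vector (block_rotation (\<chi> j. if j \<in> set xs then 2 * \<theta> $ j else 0) v) * list_rotor xs \<theta>"
proof (induction xs arbitrary: v)
  case Nil
  have "block_rotation (\<chi> j. 0) v = v" by (auto simp: block_rotation_def vec_eq_iff)
  then show ?case by simp
next
  case (Cons j xs)
  let ?a = "\<lambda>xs. \<chi> j. if j \<in> set xs then 2 * \<theta> $ j else 0"
  have a: "axis j (2 * \<theta> $ j) + ?a xs = ?a (j # xs)"
    using Cons.prems by (auto simp: vec_eq_iff axis_def)
  have "list_rotor (j # xs) \<theta> * cl_vector v =
      plane_rotor (\<theta> $ j) j * (list_rotor xs \<theta> * cl_vector v)"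
    by (simp add: mult.assoc)
  also have "\<dots> = plane_rotor (\<theta> $ j) j * cl_vector (block_rotation (?a xs) v) * list_rotor xs \<theta>"
    using Cons.prems by (simp add: Cons.IH mult.assoc)
  also have "\<dots> = cl_vector (block_rotation (axis j (2 * \<theta> $ j) + ?a xs) v) * list_rotor (j # xs) \<theta>"
    by (simp add: plane_rotor_vector block_rotation_add mult.assoc)
  finally show ?case unfolding a .
qed

lemma rotor_vector:
  "rotor \<theta> * cl_vector v = cl_vector (block_rotation (2 *\<^sub>R \<theta>) v) * rotor \<theta>"
proof -
  have "(\<chi> j. if j \<in> set (sorted_list_of_set UNIV) then 2 * \<theta> $ j else 0) = 2 *\<^sub>R \<theta>"
    by (simp add: vec_eq_iff)
  then show ?thesis
    using list_rotor_vector[of "sorted_list_of_set UNIV" \<theta> v] by (simp add: rotor_def)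
qed

lemma plane_rotor_list_rotor_commute:
  "plane_rotor t j * list_rotor xs \<theta> = list_rotor xs \<theta> * plane_rotor t j"
proof (induction xs)
  case (Cons k xs)
  have "plane_rotor t j * list_rotor (k # xs) \<theta>
      = plane_rotor t j * plane_rotor (\<theta> $ k) k * list_rotor xs \<theta>"
    by (simp add: mult.assoc)
  also have "\<dots> = plane_rotor (\<theta> $ k) k * (plane_rotor t j * list_rotor xs \<theta>)"
    by (simp only: plane_rotor_commute[of t j "\<theta> $ k"] mult.assoc)
  finally show ?case by (simp add: Cons.IH mult.assoc)
qed simp

lemma list_rotor_add: "list_rotor xs \<theta> * list_rotor xs \<theta>' = list_rotor xs (\<theta> + \<theta>')"
proof (induction xs)
  case (Cons j xs)
  have "list_rotor (j # xs) \<theta> * list_rotor (j # xs) \<theta>' =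
      plane_rotor (\<theta> $ j) j * (list_rotor xs \<theta> * plane_rotor (\<theta>' $ j) j) * list_rotor xs \<theta>'"
    by (simp add: mult.assoc)
  also have "\<dots> = plane_rotor (\<theta> $ j) j * plane_rotor (\<theta>' $ j) j *
      (list_rotor xs \<theta> * list_rotor xs \<theta>')"
    by (simp add: plane_rotor_list_rotor_commute[symmetric] mult.assoc)
  finally show ?case by (simp add: Cons.IH plane_rotor_add)
qed simp

text \<open>A homomorphism from the angles to a maximal torus of the spin group: inverses and powers
  of rotors become arithmetic of angles.\<close>

lemma rotor_add: "rotor \<theta> * rotor \<theta>' = rotor (\<theta> + \<theta>')"
  unfolding rotor_def by (rule list_rotor_add)

lemma rotor_0 [simp]: "rotor 0 = 1"
proof -
  have "list_rotor xs 0 = 1" for xs :: "'a list"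
    by (induction xs) (simp_all add: plane_rotor_def)
  then show ?thesis by (simp add: rotor_def)
qed

text \<open>A product of rotors of planes orthogonal to \<open>e\<close> commutes with \<open>e\<close>, whereas \<open>e\<close>
  anticommutes with the other vector of its own plane; so the trace kills the product of that
  plane with the rotors.\<close>

lemma cl_scalar_list_rotor:
  "distinct xs \<Longrightarrow> cl_scalar (list_rotor xs \<theta>) = (\<Prod>j\<in>set xs. cos (\<theta> $ j))"
proof (induction xs)
  case (Cons j xs)
  let ?z = "list_rotor xs \<theta>"
  have comm: "?z * cl_basis (j, b) = cl_basis (j, b) * ?z" for b
    using Cons.prems
  proof (induction xs)
    case (Cons k xs)
    have "list_rotor (k # xs) \<theta> * cl_basis (j, b)
        = plane_rotor (\<theta> $ k) k * (list_rotor xs \<theta> * cl_basis (j, b))"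
      by (simp add: mult.assoc)
    also have "\<dots> = plane_rotor (\<theta> $ k) k * cl_basis (j, b) * list_rotor xs \<theta>"
      using Cons by (simp add: mult.assoc)
    also have "\<dots> = cl_basis (j, b) * list_rotor (k # xs) \<theta>"
      using Cons.prems by (simp add: plane_rotor_commute_basis mult.assoc)
    finally show ?case .
  qed simp
  have "cl_scalar (cl_plane j * ?z) = cl_scalar (cl_basis (j, True) * ?z * cl_basis (j, False))"
    unfolding cl_plane_def mult.assoc by (subst cl_scalar_commute) (simp add: mult.assoc)
  also have "\<dots> = cl_scalar (cl_basis (j, True) * cl_basis (j, False) * ?z)"
    by (simp only: comm mult.assoc)
  also have "\<dots> = - cl_scalar (cl_plane j * ?z)"
    using cl_basis_anticommute[of "(j, True)" "(j, False)"]
    by (simp add: cl_plane_def cl_scalar_linear)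
  finally have "cl_scalar (cl_plane j * ?z) = 0" by simp
  then show ?case
    using Cons by (simp add: plane_rotor_scaleR distrib_right cl_scalar_linear)
qed (simp add: cl_scalar_linear)

lemma cl_scalar_rotor: "cl_scalar (rotor \<theta>) = (\<Prod>j\<in>UNIV. cos (\<theta> $ j))"
  by (simp add: rotor_def cl_scalar_list_rotor)

text \<open>At the angle \<open>pi / 2\<close> each factor is \<open>cl_plane j\<close>, so this is
  the ordered product of all basis vectors. Written as a rotor, it is multiplied with other rotors
  by \<open>rotor_add\<close>.\<close>

definition cl_volume :: "'m::{finite,linorder} clifford" where
  "cl_volume = rotor (\<chi> j. pi / 2)"

lemma cl_volume_vector: "cl_volume * cl_vector v = - (cl_vector v * cl_volume)"
proof -
  have "block_rotation (2 *\<^sub>R (\<chi> j. pi / 2)) v = - v"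
    by (auto simp: block_rotation_def vec_eq_iff)
  then show ?thesis
    using rotor_vector[of "\<chi> j. pi / 2" v] by (simp add: cl_volume_def cl_vector_neg)
qed

text \<open>The volume element brings the top-degree coefficient to the scalar place, up to sign; on
  the angles it acts as the shift by \<open>pi / 2\<close>.\<close>

lemma cl_scalar_volume_rotor:
  "cl_scalar (cl_volume * rotor \<theta>) = (\<Prod>j\<in>UNIV. - sin (\<theta> $ j))"
  by (simp add: cl_volume_def rotor_add cl_scalar_rotor cos_add)

section \<open>Reflections and the Pin group\<close>

definition reflection :: "'a::real_inner \<Rightarrow> 'a \<Rightarrow> 'a" where
  "reflection a v = v - (2 * (a \<bullet> v)) *\<^sub>R a"

lemma reflection_linear: "linear (reflection a)"
  by (rule linearI) (simp_all add: reflection_def algebra_simps)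

lemma reflection_involutive: "norm a = 1 \<Longrightarrow> reflection a (reflection a v) = v"
  by (simp add: reflection_def inner_diff_right norm_eq_1)

lemma orthogonal_transformation_reflection:
  "norm a = 1 \<Longrightarrow> orthogonal_transformation (reflection a)"
  unfolding orthogonal_transformation_def
  by (simp add: reflection_linear) (simp add: reflection_def algebra_simps norm_eq_1 inner_commute)

text \<open>The mirror is the perpendicular bisector of \<open>u\<close> and \<open>w\<close>: for
  equal norms, the square of \<open>norm (u - w)\<close> is twice
  \<open>(u - w) \<bullet> u\<close>.\<close>

lemma reflection_swap:
  assumes "norm u = norm w" "u \<noteq> w"
  shows "reflection ((u - w) /\<^sub>R norm (u - w)) u = w"
proof -
  have "(norm (u - w))\<^sup>2 = 2 * ((u - w) \<bullet> u)"
    using assms(1) unfolding norm_eq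
    by (simp add: power2_norm_eq_inner algebra_simps inner_commute)
  moreover have "norm (u - w) \<noteq> 0" using assms(2) by simp
  ultimately have "2 * (((u - w) \<bullet> u) / norm (u - w)) = norm (u - w)"
    by (simp add: field_simps power2_eq_square)
  then have "2 * (((u - w) /\<^sub>R norm (u - w)) \<bullet> u) = norm (u - w)"
    by (simp only: inner_scaleR_left divide_inverse_commute)
  then show ?thesis
    using assms(2) by (simp add: reflection_def)
qed

text \<open>Conjugation by an orthogonal map that takes a coordinate axis to \<open>a\<close>
  reduces the claim to a diagonal matrix with a single entry \<open>-1\<close>.\<close>

lemma det_reflection:
  fixes a :: "real ^ 'n"
  assumes "norm a = 1"
  shows "det (matrix (reflection a)) = -1"
proof -
  fix k :: 'n
  obtain f :: "real ^ 'n \<Rightarrow> real ^ 'n"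
    where f: "orthogonal_transformation f" "f (axis k 1) = a"
  proof (rule orthogonal_transformation_exists_1)
    show "norm (axis k (1 :: real)) = 1" "norm a = 1" by (simp_all add: norm_axis_1 assms)
  qed blast
  have inv: "orthogonal_transformation (inv f)"
    using f(1) by (rule orthogonal_transformation_inv)
  have lin: "linear f" "linear (inv f)"
    using f(1) inv orthogonal_transformation_linear by blast+
  have cancel: "f (inv f x) = x" for x
    using f(1) by (simp add: orthogonal_transformation_surj surj_f_inv_f)
  have "reflection a = f \<circ> reflection (axis k 1) \<circ> inv f"
  proof
    fix x
    have "axis k 1 \<bullet> inv f x = a \<bullet> x"
      using f cancel unfolding orthogonal_transformation_def by metis
    then show "reflection a x = (f \<circ> reflection (axis k 1) \<circ> inv f) x"
      by (simp add: reflection_def linear_diff[OF lin(1)] linear_scale[OF lin(1)] cancel f(2))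
  qed
  then have "matrix (reflection a) = matrix f ** matrix (reflection (axis k 1)) ** matrix (inv f)"
    by (simp add: matrix_compose lin reflection_linear linear_compose)
  moreover have "matrix f ** matrix (inv f) = mat 1"
    using matrix_compose[OF lin(2) lin(1)] cancel
    by (simp add: comp_def matrix_id_mat_1[unfolded id_def])
  then have "det (matrix f) * det (matrix (inv f)) = 1"
    by (metis det_I det_mul)
  moreover have "det (matrix (reflection (axis k (1::real)))) = -1"
  proof -
    have m: "matrix (reflection (axis k (1::real))) $ i $ j = (if i = j then if i = k then -1 else 1 else 0)"
      for i j
      by (simp add: matrix_def reflection_def inner_axis) (auto simp: axis_def)
    have "det (matrix (reflection (axis k (1::real)))) = (\<Prod>i\<in>UNIV. if i = k then -1 else 1)"
      by (subst det_diagonal) (simp_all add: m)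
    then show ?thesis by simp
  qed
  ultimately show ?thesis by (simp add: det_mul algebra_simps)
qed

section \<open>Products of reflections\<close>

definition reflections :: "'a::real_inner list \<Rightarrow> 'a \<Rightarrow> 'a" where
  "reflections vs = foldr (\<lambda>a f. reflection a \<circ> f) vs id"

lemma reflections_simps [simp]:
  "reflections [] = id"
  "reflections (a # vs) = reflection a \<circ> reflections vs"
  by (simp_all add: reflections_def)

lemma orthogonal_transformation_axes_id:
  fixes T :: "real ^ 'n \<Rightarrow> real ^ 'n"
  assumes "linear T" "\<And>i. T (axis i 1) = axis i 1"
  shows "T = id"
  by (rule linear_eq_stdbasis) (use assms in \<open>auto simp: Basis_vec_def linear_id\<close>)

text \<open>The Cartan-Dieudonne argument, by induction on the number of axes that are moved: one
  reflection puts a moved axis back.\<close>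

theorem orthogonal_transformation_reflections:
  fixes T :: "real ^ 'n \<Rightarrow> real ^ 'n"
  assumes "orthogonal_transformation T"
  shows "\<exists>vs. (\<forall>a\<in>set vs. norm a = 1) \<and> T = reflections vs"
  using assms
proof (induction "card {i. T (axis i 1) \<noteq> axis i 1}" arbitrary: T rule: less_induct)
  case less
  show ?case
  proof (cases "\<exists>i. T (axis i 1) \<noteq> axis i 1")
    case False
    then have "T = id"
      using less.prems by (intro orthogonal_transformation_axes_id)
        (auto simp: orthogonal_transformation_linear)
    then show ?thesis by (intro exI[of _ "[]"]) simp
  next
    case True
    then obtain i where i: "T (axis i 1) \<noteq> axis i 1" by blast
    define a where "a = (T (axis i 1) - axis i 1) /\<^sub>R norm (T (axis i 1) - axis i 1)"
    have a: "norm a = 1" using i by (simp add: a_def)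
    have Ti: "reflection a (T (axis i 1)) = axis i 1"
      unfolding a_def using i less.prems
      by (intro reflection_swap) (simp_all add: orthogonal_transformation_norm)
    \<comment> \<open>Axes that \<open>T\<close> fixes stay fixed: \<open>T (axis i 1)\<close> and
      \<open>axis i 1\<close> have the same inner product with them, so \<open>a\<close> is
      orthogonal to them.\<close>
    have Tj: "reflection a (T (axis j 1)) = axis j 1" if j: "T (axis j 1) = axis j 1" for j
    proof -
      have "T (axis i 1) \<bullet> T (axis j 1) = axis i (1 :: real) \<bullet> axis j 1"
        using less.prems unfolding orthogonal_transformation_def by blast
      then have "a \<bullet> axis j 1 = 0" by (simp add: a_def j inner_diff_left)
      then show ?thesis by (simp add: j reflection_def)
    qed
    have o: "orthogonal_transformation (reflection a \<circ> T)"
      using less.prems orthogonal_transformation_reflection[OF a]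
      by (rule orthogonal_transformation_compose[rotated])
    have "card {j. (reflection a \<circ> T) (axis j 1) \<noteq> axis j 1} < card {j. T (axis j 1) \<noteq> axis j 1}"
      using i Ti Tj by (intro psubset_card_mono) auto
    from less.hyps[OF this o] obtain vs
      where vs: "\<forall>a\<in>set vs. norm a = 1" "reflection a \<circ> T = reflections vs" by blast
    have "T = reflections (a # vs)"
      unfolding reflections_simps vs(2)[symmetric]
      by (simp add: fun_eq_iff reflection_involutive[OF a])
    with vs(1) a show ?thesis by (intro exI[of _ "a # vs"]) simp
  qed
qed

lemma reflections_linear: "linear (reflections vs)"
proof (induction vs)
  case Nil
  show ?case unfolding reflections_simps by (rule linear_id)
next
  case (Cons a vs)
  then show ?case unfolding reflections_simps by (rule linear_compose[OF _ reflection_linear])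
qed

lemma det_reflections:
  fixes vs :: "(real ^ 'n) list"
  shows "\<forall>a\<in>set vs. norm a = 1 \<Longrightarrow> det (matrix (reflections vs)) = (-1) ^ length vs"
proof (induction vs)
  case Nil
  show ?case by (simp only: reflections_simps matrix_id_mat_1 det_I list.size power_0)
next
  case (Cons a vs)
  have "matrix (reflections (a # vs)) = matrix (reflection a) ** matrix (reflections vs)"
    unfolding reflections_simps by (rule matrix_compose[OF reflections_linear reflection_linear])
  then show ?case using Cons by (simp only: det_mul) (simp add: det_reflection)
qed

lemma cl_vector_reflection:
  assumes "norm a = 1"
  shows "cl_vector a * cl_vector v = - (cl_vector (reflection a v) * cl_vector a)"
proof -
  have "cl_vector a * cl_vector v = - (2 * (a \<bullet> v)) *\<^sub>R 1 - cl_vector v * cl_vector a"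
    using cl_vector_anticommutator[of a v] by (simp only: eq_diff_eq)
  also have "\<dots> = - ((cl_vector v - (2 * (a \<bullet> v)) *\<^sub>R cl_vector a) * cl_vector a)"
    by (simp add: left_diff_distrib cl_vector_unit_square[OF assms])
  finally show ?thesis by (simp add: reflection_def cl_vector_diff cl_vector_scaleR)
qed

lemma cl_vectors_reflections:
  assumes "\<forall>a\<in>set vs. norm a = 1"
  shows "prod_list (map cl_vector vs) * cl_vector v =
    (-1) ^ length vs *\<^sub>R (cl_vector (reflections vs v) * prod_list (map cl_vector vs))"
  using assms
proof (induction vs)
  case (Cons a vs)
  have "prod_list (map cl_vector (a # vs)) * cl_vector v
      = cl_vector a * (prod_list (map cl_vector vs) * cl_vector v)"
    by (simp add: mult.assoc)
  also have "\<dots> = (-1) ^ length vs *\<^sub>R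
      (cl_vector a * cl_vector (reflections vs v) * prod_list (map cl_vector vs))"
    using Cons by (simp add: mult.assoc)
  also have "cl_vector a * cl_vector (reflections vs v) =
      - (cl_vector (reflections (a # vs) v) * cl_vector a)"
    using Cons.prems by (simp add: cl_vector_reflection)
  finally show ?case by (simp add: mult.assoc)
qed simp

lemma cl_vectors_volume:
  "prod_list (map cl_vector vs) * cl_volume =
    (-1) ^ length vs *\<^sub>R (cl_volume * prod_list (map cl_vector vs))"
proof (induction vs)
  case (Cons a vs)
  have "prod_list (map cl_vector (a # vs)) * cl_volume
      = cl_vector a * (prod_list (map cl_vector vs) * cl_volume)"
    by (simp add: mult.assoc)
  also have "\<dots> = (-1) ^ length vs *\<^sub>R (cl_vector a * cl_volume * prod_list (map cl_vector vs))"
    by (simp add: Cons.IH mult.assoc)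
  also have "cl_vector a * cl_volume = - (cl_volume * cl_vector a)"
    by (simp add: cl_volume_vector)
  finally show ?case by (simp add: mult.assoc)
qed simp

lemma cl_vectors_inverse:
  "\<forall>a\<in>set vs. norm a = 1 \<Longrightarrow>
    \<exists>y. prod_list (map cl_vector vs) * y = 1 \<and> y * prod_list (map cl_vector vs) = 1"
proof (induction vs)
  case (Cons a vs)
  then obtain y where y: "prod_list (map cl_vector vs) * y = 1" "y * prod_list (map cl_vector vs) = 1"
    by auto
  have a: "cl_vector a * cl_vector a = -1" using Cons.prems by (simp add: cl_vector_unit_square)
  have "prod_list (map cl_vector (a # vs)) * (- (y * cl_vector a)) =
      - (cl_vector a * (prod_list (map cl_vector vs) * y) * cl_vector a)"
    by (simp add: mult.assoc)
  moreover have "- (y * cl_vector a) * prod_list (map cl_vector (a # vs)) =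
      - (y * (cl_vector a * cl_vector a) * prod_list (map cl_vector vs))"
    by (simp add: mult.assoc)
  ultimately show ?case by (intro exI[of _ "- (y * cl_vector a)"]) (simp add: y a)
qed simp

section \<open>The grade involution and lifts to the Pin group\<close>

lemma minus_one_power_card_sym_diff:
  fixes A B :: "'a::finite set"
  shows "(-1 :: real) ^ card (sym_diff A B) = (-1) ^ card A * (-1) ^ card B"
  using prod_sym_diff_sign[of A B "\<lambda>_. -1"] by simp

lemma cl_grade_mult: "cl_grade (x * y) = cl_grade x * cl_grade y"
proof (rule clifford_eqI)
  fix C :: "('a \<times> bool) set"
  have "(-1) ^ card C * (blade_sign A (sym_diff A C) * cl_coeff x A * cl_coeff y (sym_diff A C)) =
    blade_sign A (sym_diff A C) * ((-1) ^ card A * cl_coeff x A) *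
      ((-1) ^ card (sym_diff A C) * cl_coeff y (sym_diff A C))" for A
  proof -
    have "(-1 :: real) ^ card A * (-1) ^ card A = 1" by (simp flip: power_add mult_2)
    moreover have "b * (p * u) * (p * c * v) = p * p * (c * (b * u * v))" for b c p u v :: real
      by (simp only: mult_ac)
    ultimately show ?thesis unfolding minus_one_power_card_sym_diff by simp
  qed
  then show "cl_coeff (cl_grade (x * y)) C = cl_coeff (cl_grade x * cl_grade y) C"
    unfolding cl_grade.rep_eq times_clifford.rep_eq sum_distrib_left by (intro sum.cong refl)
qed

lemma cl_grade_one: "cl_grade 1 = 1"
  by (rule clifford_eqI) (simp add: cl_grade.rep_eq one_clifford.rep_eq)

lemma cl_grade_vector: "cl_grade (cl_vector v) = - cl_vector v"
  by (rule clifford_eqI)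
     (auto simp: cl_grade.rep_eq uminus_clifford.rep_eq cl_coeff_vector sum_distrib_left
       sum_negf[symmetric] intro!: sum.cong)

lemma cl_grade_vectors:
  "cl_grade (prod_list (map cl_vector vs)) = (-1) ^ length vs *\<^sub>R prod_list (map cl_vector vs)"
  by (induction vs) (simp_all add: cl_grade_one cl_grade_mult cl_grade_vector)

text \<open>The sign from \<open>cl_grade\<close> cancels the one picked up when the product passes
  \<open>cl_vector v\<close>, which leaves exactly the composed reflections; injectivity of
  \<open>cl_vector\<close> excludes any other map.\<close>

lemma pin_lift_vectors_iff:
  assumes "\<forall>a\<in>set vs. norm a = 1"
  shows "pin_lift (prod_list (map cl_vector vs)) T \<longleftrightarrow> T = reflections vs"
proof -
  let ?x = "prod_list (map cl_vector vs)"
  obtain y where y: "?x * y = 1" "y * ?x = 1" using cl_vectors_inverse[OF assms] by blast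
  have "cl_grade ?x * cl_vector v * cl_inverse ?x = cl_vector (reflections vs v)" for v
  proof -
    have "cl_grade ?x * cl_vector v * cl_inverse ?x
        = (-1) ^ length vs *\<^sub>R (?x * cl_vector v) * y"
      by (simp add: cl_grade_vectors cl_inverseI[OF y])
    also have "\<dots> = cl_vector (reflections vs v) * (?x * y)"
      unfolding cl_vectors_reflections[OF assms]
      by (simp add: mult.assoc flip: power_add mult_2)
    finally show ?thesis by (simp add: y)
  qed
  moreover have "?x \<in> Pin" using assms by (auto simp: Pin_def)
  ultimately show ?thesis
    unfolding pin_lift_def by (auto simp: cl_vector_inject)
qed

lemma pin_lift_exists:
  assumes "orthogonal_transformation T"
  shows "\<exists>x. pin_lift x T"
  using orthogonal_transformation_reflections[OF assms] pin_lift_vectors_iff by blast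

text \<open>The commutation rules of a lift depend on the vectors representing it only through the
  parity of their number, and this parity is the determinant.\<close>

lemma pin_liftE:
  assumes "pin_lift x T"
  obtains y where "x * y = 1" "y * x = 1" "cl_inverse x = y"
    and "\<And>v. x * cl_vector v = det (matrix T) *\<^sub>R (cl_vector (T v) * x)"
    and "x * cl_volume = det (matrix T) *\<^sub>R (cl_volume * x)"
    and "det (matrix T) * det (matrix T) = 1"
proof -
  obtain vs where vs: "\<forall>a\<in>set vs. norm a = 1" and x: "x = prod_list (map cl_vector vs)"
    using assms by (auto simp: pin_lift_def Pin_def)
  have T: "T = reflections vs" using assms pin_lift_vectors_iff[OF vs] x by simp
  have d: "det (matrix T) = (-1) ^ length vs" unfolding T by (rule det_reflections[OF vs])
  obtain y where y: "x * y = 1" "y * x = 1" using cl_vectors_inverse[OF vs] x by blast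
  show thesis
    by (rule that[OF y cl_inverseI[OF y]])
       (use cl_vectors_reflections[OF vs] cl_vectors_volume[of vs] in
         \<open>simp_all add: d flip: x T power_add mult_2\<close>)
qed

section \<open>Conjugation of rotors\<close>

text \<open>Both sides of the first equation lift the same rotation, so they differ by a central
  element. The determinant enters because odd elements anticommute with the volume element.\<close>

lemma pin_conjugate_rotor:
  assumes x: "pin_lift x \<Psi>" and \<Psi>: "orthogonal_transformation \<Psi>"
    and int: "\<And>v. \<Psi> (block_rotation (2 *\<^sub>R \<theta>) v) = block_rotation (2 *\<^sub>R \<theta>') (\<Psi> v)"
  obtains \<delta> where "x * rotor \<theta> * cl_inverse x = \<delta> *\<^sub>R rotor \<theta>'"
    and "(\<Prod>j\<in>UNIV. cos (\<theta> $ j)) = \<delta> * (\<Prod>j\<in>UNIV. cos (\<theta>' $ j))"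
    and "det (matrix \<Psi>) * (\<Prod>j\<in>UNIV. sin (\<theta> $ j)) = \<delta> * (\<Prod>j\<in>UNIV. sin (\<theta>' $ j))"
proof -
  define d where "d = det (matrix \<Psi>)"
  obtain y where y: "x * y = 1" "y * x = 1" "cl_inverse x = y"
    and xv: "\<And>v. x * cl_vector v = d *\<^sub>R (cl_vector (\<Psi> v) * x)"
    and xvol: "x * cl_volume = d *\<^sub>R (cl_volume * x)" and dd: "d * d = 1"
    using pin_liftE[OF x, folded d_def] by blast
  \<comment> \<open>The inverse obeys the same rule with \<open>\<Psi>\<close> read backwards, as
    the sign \<open>d\<close> is its own inverse.\<close>
  have yv: "y * cl_vector (\<Psi> u) = d *\<^sub>R (cl_vector u * y)" for u
  proof -
    have "d *\<^sub>R (cl_vector u * y) = d *\<^sub>R (y * (x * cl_vector u) * y)"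
      by (simp add: y mult.assoc[symmetric])
    also have "\<dots> = (d * d) *\<^sub>R (y * cl_vector (\<Psi> u) * (x * y))"
      by (simp add: xv mult.assoc)
    finally show ?thesis by (simp add: dd y)
  qed
  define w where "w = x * rotor \<theta> * y"
  have wv: "w * cl_vector v = cl_vector (block_rotation (2 *\<^sub>R \<theta>') v) * w" for v
  proof -
    obtain u where u: "v = \<Psi> u" using orthogonal_transformation_surj[OF \<Psi>] by (auto simp: surj_def)
    have "w * cl_vector v = x * rotor \<theta> * (y * cl_vector (\<Psi> u))"
      by (simp add: w_def u mult.assoc)
    also have "\<dots> = d *\<^sub>R (x * (rotor \<theta> * cl_vector u) * y)"
      by (simp add: yv mult.assoc)
    also have "\<dots> = d *\<^sub>R (x * cl_vector (block_rotation (2 *\<^sub>R \<theta>) u) * (rotor \<theta> * y))"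
      by (simp add: rotor_vector mult.assoc)
    also have "\<dots> = (d * d) *\<^sub>R (cl_vector (\<Psi> (block_rotation (2 *\<^sub>R \<theta>) u)) * w)"
      by (simp add: xv w_def mult.assoc)
    finally show ?thesis by (simp add: dd int u)
  qed
  define z where "z = rotor (- \<theta>') * w"
  have zv: "z * cl_vector v = cl_vector v * z" for v
  proof -
    have "z * cl_vector v = rotor (- \<theta>') * cl_vector (block_rotation (2 *\<^sub>R \<theta>') v) * w"
      by (simp add: z_def wv mult.assoc)
    also have "\<dots> = cl_vector (block_rotation (2 *\<^sub>R (- \<theta>')) (block_rotation (2 *\<^sub>R \<theta>') v)) * z"
      by (simp only: rotor_vector z_def mult.assoc)
    also have "block_rotation (2 *\<^sub>R (- \<theta>')) (block_rotation (2 *\<^sub>R \<theta>') v) = v"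
      unfolding block_rotation_add by simp
    finally show ?thesis .
  qed
  define \<delta> where "\<delta> = cl_scalar z"
  have "z = \<delta> *\<^sub>R 1"
    unfolding \<delta>_def using zv[of "axis _ 1"] by (intro clifford_centre) (simp add: cl_vector_axis)
  moreover have "w = rotor \<theta>' * z"
    by (simp add: z_def mult.assoc[symmetric] rotor_add)
  ultimately have w: "w = \<delta> *\<^sub>R rotor \<theta>'" by simp
  have "cl_scalar w = cl_scalar (rotor \<theta>)"
    unfolding w_def by (subst cl_scalar_commute) (simp add: mult.assoc[symmetric] y)
  then have "(\<Prod>j\<in>UNIV. cos (\<theta> $ j)) = \<delta> * (\<Prod>j\<in>UNIV. cos (\<theta>' $ j))"
    by (simp add: w cl_scalar_linear cl_scalar_rotor)
  moreover have "cl_scalar (cl_volume * w) = d * cl_scalar (cl_volume * rotor \<theta>)"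
  proof -
    have "cl_scalar (cl_volume * w) = cl_scalar (y * (cl_volume * x) * rotor \<theta>)"
      unfolding w_def by (simp only: mult.assoc[symmetric]) (subst cl_scalar_commute, simp add: mult.assoc)
    also have "cl_volume * x = d *\<^sub>R (x * cl_volume)" by (simp add: xvol dd)
    also have "cl_scalar (y * (d *\<^sub>R (x * cl_volume)) * rotor \<theta>) = d * cl_scalar (cl_volume * rotor \<theta>)"
      by (simp add: cl_scalar_linear mult.assoc[symmetric] y)
    finally show ?thesis .
  qed
  then have "d * (\<Prod>j\<in>UNIV. - sin (\<theta> $ j)) = \<delta> * (\<Prod>j\<in>UNIV. - sin (\<theta>' $ j))"
    by (simp only: w mult_scaleR_right cl_scalar_linear cl_scalar_volume_rotor)
  then have "d * (\<Prod>j\<in>UNIV. sin (\<theta> $ j)) = \<delta> * (\<Prod>j\<in>UNIV. sin (\<theta>' $ j))"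
    by (simp add: prod_uminus mult_ac)
  ultimately show thesis
    using w unfolding w_def y(3)[symmetric] d_def by (intro that[of \<delta>])
qed

text \<open>Reversing an angle changes the sign of its sine only, while adding \<open>pi * n\<close>
  multiplies sine and cosine by the same sign. So the cosines see \<open>n\<close> alone and the
  sines see both \<open>n\<close> and \<open>e\<close>.\<close>

lemma prod_angles_match:
  fixes \<theta> \<theta>' :: "real ^ 'm" and e :: "'m \<Rightarrow> int" and n :: "'m \<Rightarrow> int"
  assumes \<sigma>: "bij \<sigma>" and e: "\<And>j. e j \<in> {-1, 1}"
    and match: "\<And>j. of_int (e j) * \<theta> $ j = \<theta>' $ \<sigma> j + pi * of_int (n j)"
  shows "(\<Prod>j\<in>UNIV. cos (\<theta> $ j)) = (-1) powi (\<Sum>j\<in>UNIV. n j) * (\<Prod>j\<in>UNIV. cos (\<theta>' $ j))"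
    and "(\<Prod>j\<in>UNIV. sin (\<theta> $ j)) =
      of_int (\<Prod>j\<in>UNIV. e j) * (-1) powi (\<Sum>j\<in>UNIV. n j) * (\<Prod>j\<in>UNIV. sin (\<theta>' $ j))"
proof -
  have sgn: "cos (pi * of_int k) = (-1) powi k" "sin (pi * of_int k) = 0" for k
    by (simp_all add: cos_npi_int sin_npi_int power_int_minus_left)
  have "cos (\<theta> $ j) = (-1) powi (n j) * cos (\<theta>' $ \<sigma> j)"
    "sin (\<theta> $ j) = of_int (e j) * (-1) powi (n j) * sin (\<theta>' $ \<sigma> j)" for j
  proof -
    have "cos (\<theta> $ j) = cos (of_int (e j) * \<theta> $ j)" "sin (\<theta> $ j) = of_int (e j) * sin (of_int (e j) * \<theta> $ j)"
      using e[of j] by auto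
    then show "cos (\<theta> $ j) = (-1) powi (n j) * cos (\<theta>' $ \<sigma> j)"
      "sin (\<theta> $ j) = of_int (e j) * (-1) powi (n j) * sin (\<theta>' $ \<sigma> j)"
      unfolding match cos_add sin_add sgn by simp_all
  qed
  moreover have "(\<Prod>j\<in>UNIV. (-1 :: real) powi (n j)) = (-1) powi (\<Sum>j\<in>UNIV. n j)"
  proof -
    have "(\<Prod>j\<in>A. (-1 :: real) powi (n j)) = (-1) powi (\<Sum>j\<in>A. n j)" if "finite A" for A
      using that by induction (simp_all add: power_int_add)
    then show ?thesis by simp
  qed
  moreover have "(\<Prod>j\<in>UNIV. f (\<theta>' $ \<sigma> j)) = (\<Prod>j\<in>UNIV. f (\<theta>' $ j))" for f :: "real \<Rightarrow> real"
    by (rule prod.reindex_bij_betw[OF \<sigma>])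
  ultimately show "(\<Prod>j\<in>UNIV. cos (\<theta> $ j)) = (-1) powi (\<Sum>j\<in>UNIV. n j) * (\<Prod>j\<in>UNIV. cos (\<theta>' $ j))"
    and "(\<Prod>j\<in>UNIV. sin (\<theta> $ j)) =
      of_int (\<Prod>j\<in>UNIV. e j) * (-1) powi (\<Sum>j\<in>UNIV. n j) * (\<Prod>j\<in>UNIV. sin (\<theta>' $ j))"
    by (simp_all add: prod.distrib)
qed

lemma prod_signs_square:
  assumes "\<And>j. e j \<in> {-1, 1}"
  shows "of_int (\<Prod>j\<in>A. e j) * of_int (\<Prod>j\<in>A. e j) = (1 :: 'a::comm_ring_1)"
proof -
  have "e j * e j = 1" for j using assms[of j] by auto
  then have "(\<Prod>j\<in>A. e j) * (\<Prod>j\<in>A. e j) = 1" by (simp flip: prod.distrib)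
  then show ?thesis by (metis of_int_1 of_int_mult)
qed

text \<open>The cosines determine the factor \<open>\<delta>\<close> of
  \<open>pin_conjugate_rotor\<close>, after which the sines determine the determinant. This works
  even if equal angles let \<open>\<Psi>\<close> mix several planes.\<close>

lemma det_intertwiner:
  fixes \<theta> \<theta>' :: "real ^ 'm::{finite,linorder}" and e :: "'m \<Rightarrow> int" and n :: "'m \<Rightarrow> int"
  assumes \<Psi>: "orthogonal_transformation \<Psi>"
    and int: "\<And>v. \<Psi> (block_rotation (2 *\<^sub>R \<theta>) v) = block_rotation (2 *\<^sub>R \<theta>') (\<Psi> v)"
    and match: "bij \<sigma>" "\<And>j. e j \<in> {-1, 1}"
      "\<And>j. of_int (e j) * \<theta> $ j = \<theta>' $ \<sigma> j + pi * of_int (n j)"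
    and nz: "\<And>j. cos (\<theta> $ j) \<noteq> 0" "\<And>j. sin (\<theta> $ j) \<noteq> 0"
  shows "det (matrix \<Psi>) = of_int (\<Prod>j\<in>UNIV. e j)"
proof -
  let ?N = "(-1 :: real) powi (\<Sum>j\<in>UNIV. n j)"
  note prods = prod_angles_match[OF match]
  obtain x where "pin_lift x \<Psi>" using pin_lift_exists[OF \<Psi>] by blast
  then obtain \<delta> where d: "(\<Prod>j\<in>UNIV. cos (\<theta> $ j)) = \<delta> * (\<Prod>j\<in>UNIV. cos (\<theta>' $ j))"
    "det (matrix \<Psi>) * (\<Prod>j\<in>UNIV. sin (\<theta> $ j)) = \<delta> * (\<Prod>j\<in>UNIV. sin (\<theta>' $ j))"
    using pin_conjugate_rotor[OF _ \<Psi> int] by metis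
  have nz': "(\<Prod>j\<in>UNIV. cos (\<theta> $ j)) \<noteq> 0" "(\<Prod>j\<in>UNIV. sin (\<theta> $ j)) \<noteq> 0"
    using nz by simp_all
  then have "\<delta> = ?N" using d(1) prods(1) by auto
  moreover have "of_int (\<Prod>j\<in>UNIV. e j) * (\<Prod>j\<in>UNIV. sin (\<theta> $ j)) = ?N * (\<Prod>j\<in>UNIV. sin (\<theta>' $ j))"
    unfolding prods(2) using prod_signs_square[of e UNIV, where 'a = real, OF match(2)]
    by (simp only: mult.assoc[symmetric] mult_1_left)
  ultimately show ?thesis using d(2) nz'(2) by (metis mult_right_cancel)
qed

text \<open>With the determinant already known, the sines alone fix the factor. This form covers
  \<open>q = 2\<close>, where the cosines of the half angles vanish.\<close>

lemma pin_conjugate_rotor_match: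
  fixes \<theta> \<theta>' :: "real ^ 'm::{finite,linorder}" and e :: "'m \<Rightarrow> int" and n :: "'m \<Rightarrow> int"
  assumes x: "pin_lift x \<Psi>" and \<Psi>: "orthogonal_transformation \<Psi>"
    and int: "\<And>v. \<Psi> (block_rotation (2 *\<^sub>R \<theta>) v) = block_rotation (2 *\<^sub>R \<theta>') (\<Psi> v)"
    and match: "bij \<sigma>" "\<And>j. e j \<in> {-1, 1}"
      "\<And>j. of_int (e j) * \<theta> $ j = \<theta>' $ \<sigma> j + pi * of_int (n j)"
    and nz: "\<And>j. sin (\<theta> $ j) \<noteq> 0"
    and det: "det (matrix \<Psi>) = of_int (\<Prod>j\<in>UNIV. e j)"
  shows "x * rotor \<theta> * cl_inverse x = (-1) powi (\<Sum>j\<in>UNIV. n j) *\<^sub>R rotor \<theta>'"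
proof -
  let ?N = "(-1 :: real) powi (\<Sum>j\<in>UNIV. n j)"
  note prods = prod_angles_match[OF match]
  obtain \<delta> where d: "x * rotor \<theta> * cl_inverse x = \<delta> *\<^sub>R rotor \<theta>'"
    "det (matrix \<Psi>) * (\<Prod>j\<in>UNIV. sin (\<theta> $ j)) = \<delta> * (\<Prod>j\<in>UNIV. sin (\<theta>' $ j))"
    using pin_conjugate_rotor[OF x \<Psi> int] by metis
  have nz': "(\<Prod>j\<in>UNIV. sin (\<theta> $ j)) \<noteq> 0" using nz by simp
  have "of_int (\<Prod>j\<in>UNIV. e j) * (\<Prod>j\<in>UNIV. sin (\<theta> $ j)) = ?N * (\<Prod>j\<in>UNIV. sin (\<theta>' $ j))"
    unfolding prods(2) using prod_signs_square[of e UNIV, where 'a = real, OF match(2)]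
    by (simp only: mult.assoc[symmetric] mult_1_left)
  with d(2) det have "\<delta> = ?N" using nz' prods(2) by auto
  with d(1) show ?thesis by simp
qed

text \<open>In complex coordinates: the \<open>j\<close>-th one moves to place
  \<open>\<sigma> j\<close> and is conjugated if \<open>e j = -1\<close>. Components are pulled
  back, hence \<open>inv \<sigma>\<close>.\<close>

definition block_permutation ::
  "('m::finite \<Rightarrow> 'm) \<Rightarrow> ('m \<Rightarrow> int) \<Rightarrow> real ^ ('m \<times> bool) \<Rightarrow> real ^ ('m \<times> bool)" where
  "block_permutation \<sigma> e v =
     (\<chi> i. (if snd i then of_int (e (inv \<sigma> (fst i))) else 1) * v $ (inv \<sigma> (fst i), snd i))"

lemma orthogonal_transformation_block_permutation:
  assumes \<sigma>: "bij \<sigma>" and e: "\<And>j. e j \<in> {-1, 1}"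
  shows "orthogonal_transformation (block_permutation \<sigma> e)"
  unfolding orthogonal_transformation_def
proof (intro conjI allI)
  show "linear (block_permutation \<sigma> e)"
    by (rule linearI) (auto simp: block_permutation_def vec_eq_iff algebra_simps)
  fix v w :: "real ^ ('a \<times> bool)"
  have "bij (\<lambda>i :: 'a \<times> bool. (inv \<sigma> (fst i), snd i))"
    using bij_imp_bij_inv[OF \<sigma>] unfolding bij_def inj_def surj_def by fastforce
  then have "(\<Sum>i\<in>UNIV. v $ (inv \<sigma> (fst i), snd i) * w $ (inv \<sigma> (fst i), snd i)) = (\<Sum>i\<in>UNIV. v $ i * w $ i)"
    by (rule sum.reindex_bij_betw[where g = "\<lambda>i. v $ i * w $ i"])
  moreover have "block_permutation \<sigma> e v $ i * block_permutation \<sigma> e w $ i =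
      v $ (inv \<sigma> (fst i), snd i) * w $ (inv \<sigma> (fst i), snd i)" for i
    using e[of "inv \<sigma> (fst i)"] by (auto simp: block_permutation_def)
  ultimately show "block_permutation \<sigma> e v \<bullet> block_permutation \<sigma> e w = v \<bullet> w"
    by (simp add: inner_vec_def)
qed

lemma block_permutation_rotation:
  assumes \<sigma>: "bij \<sigma>" and e: "\<And>j. e j \<in> {-1, 1}"
    and match: "\<And>j. of_int (e j) * \<theta> $ j = \<theta>' $ \<sigma> j + 2 * pi * of_int (n j)"
  shows "block_permutation \<sigma> e (block_rotation \<theta> v) = block_rotation \<theta>' (block_permutation \<sigma> e v)"
proof -
  have "sin (\<theta>' $ i) = of_int (e (inv \<sigma> i)) * sin (\<theta> $ inv \<sigma> i)"
    "cos (\<theta>' $ i) = cos (\<theta> $ inv \<sigma> i)" for i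
  proof -
    have "\<theta>' $ i = of_int (e (inv \<sigma> i)) * \<theta> $ inv \<sigma> i + 2 * pi * of_int (- n (inv \<sigma> i))"
      using match[of "inv \<sigma> i"] \<sigma> by (simp add: bij_is_surj surj_f_inv_f)
    then have "sin (\<theta>' $ i) = sin (of_int (e (inv \<sigma> i)) * \<theta> $ inv \<sigma> i)"
      "cos (\<theta>' $ i) = cos (of_int (e (inv \<sigma> i)) * \<theta> $ inv \<sigma> i)"
      using sin_cos_eq_iff by blast+
    then show "sin (\<theta>' $ i) = of_int (e (inv \<sigma> i)) * sin (\<theta> $ inv \<sigma> i)"
      "cos (\<theta>' $ i) = cos (\<theta> $ inv \<sigma> i)"
      using e[of "inv \<sigma> i"] by auto
  qed
  moreover have "of_int (e j) * (of_int (e j) * x) = (x :: real)" for j x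
    using e[of j] by auto
  ultimately show ?thesis
    by (auto simp: block_permutation_def block_rotation_def vec_eq_iff algebra_simps)
qed

text \<open>Interchanging two planes is an even permutation of coordinates, so only the conjugated
  planes count. Instead of expanding a matrix, the proof applies \<open>det_intertwiner\<close> to a
  test rotation.\<close>

lemma det_block_permutation:
  fixes \<sigma> :: "'m::{finite,linorder} \<Rightarrow> 'm"
  assumes \<sigma>: "bij \<sigma>" and e: "\<And>j. e j \<in> {-1, 1}"
  shows "det (matrix (block_permutation \<sigma> e)) = of_int (\<Prod>j\<in>UNIV. e j)"
proof -
  \<comment> \<open>Any common angle whose sine and cosine are both nonzero would do;
    \<open>\<theta>'\<close> carries the permuted signs.\<close>
  define \<theta> :: "real ^ 'm::{finite,linorder}" where "\<theta> = (\<chi> j. pi / 4)"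
  define \<theta>' :: "real ^ 'm::{finite,linorder}" where "\<theta>' = (\<chi> i. of_int (e (inv \<sigma> i)) * (pi / 4))"
  have match: "of_int (e j) * \<theta> $ j = \<theta>' $ \<sigma> j + pi * of_int 0" for j
    using \<sigma> by (simp add: \<theta>_def \<theta>'_def bij_is_inj)
  show ?thesis
  proof (rule det_intertwiner[where n = "\<lambda>_. 0"])
    show "block_permutation \<sigma> e (block_rotation (2 *\<^sub>R \<theta>) v) =
        block_rotation (2 *\<^sub>R \<theta>') (block_permutation \<sigma> e v)" for v
      by (rule block_permutation_rotation[where n = "\<lambda>_. 0"]) (use \<sigma> e match in auto)
  qed (use \<sigma> e match in \<open>auto simp: orthogonal_transformation_block_permutation \<theta>_def cos_45 sin_45\<close>)
qed

section \<open>Matching the rotation angles\<close>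

lemma dim_coordinate_subspace:
  fixes d :: "'n::finite set"
  shows "dim {x :: real ^ 'n. \<forall>i. i \<notin> d \<longrightarrow> x $ i = 0} = card d"
  using dim_substandard_cart[of d, where 'a = real] by (simp add: dim_vec_eq)

text \<open>The eigenspaces of \<open>g + g\<^sup>-\<^sup>1\<close> for a block rotation \<open>g\<close> are coordinate subspaces, so their
  dimensions count the blocks with a given cosine.\<close>

lemma block_rotation_conjugate_cos:
  fixes \<theta> \<theta>' :: "real ^ 'm"
  assumes \<Psi>: "orthogonal_transformation \<Psi>"
    and int: "\<And>v. \<Psi> (block_rotation \<theta> v) = block_rotation \<theta>' (\<Psi> v)"
  obtains \<sigma> where "bij \<sigma>" "\<And>j. cos (\<theta> $ j) = cos (\<theta>' $ \<sigma> j)"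
proof -
  define E where "E \<theta> u = {v. block_rotation \<theta> v + block_rotation (- \<theta>) v = (2 * u) *\<^sub>R v}"
    for \<theta> :: "real ^ 'm" and u
  have lin: "linear \<Psi>" using \<Psi> by (rule orthogonal_transformation_linear)
  have dimE: "dim (E \<theta> u) = 2 * card {j. cos (\<theta> $ j) = u}" for \<theta> :: "real ^ 'm" and u
  proof -
    have "(block_rotation \<theta> v + block_rotation (- \<theta>) v) $ (j, b) = 2 * cos (\<theta> $ j) * v $ (j, b)"
      for v j b
      by (simp add: block_rotation_def algebra_simps)
    then have "E \<theta> u = {v. \<forall>i. i \<notin> {j. cos (\<theta> $ j) = u} \<times> UNIV \<longrightarrow> v $ i = 0}"
      by (auto simp: E_def vec_eq_iff)
    then show ?thesis by (simp only: dim_coordinate_subspace) (simp add: card_cartesian_product)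
  qed
  have int': "\<Psi> (block_rotation (- \<theta>) v) = block_rotation (- \<theta>') (\<Psi> v)" for v
  proof -
    have "block_rotation (- \<theta>') (\<Psi> v)
        = block_rotation (- \<theta>') (\<Psi> (block_rotation \<theta> (block_rotation (- \<theta>) v)))"
      by (simp add: block_rotation_add)
    also have "\<dots> = \<Psi> (block_rotation (- \<theta>) v)"
      by (simp only: int) (simp add: block_rotation_add)
    finally show ?thesis by simp
  qed
  have "\<Psi> ` E \<theta> u = E \<theta>' u" for u
  proof -
    have "\<Psi> v \<in> E \<theta>' u \<longleftrightarrow> v \<in> E \<theta> u" for v
    proof -
      have "\<Psi> v \<in> E \<theta>' u \<longleftrightarrow>
          \<Psi> (block_rotation \<theta> v + block_rotation (- \<theta>) v) = \<Psi> ((2 * u) *\<^sub>R v)"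
        by (simp add: E_def int int' linear_add[OF lin] linear_scale[OF lin])
      then show ?thesis
        using orthogonal_transformation_inj[OF \<Psi>] by (simp add: E_def inj_eq)
    qed
    moreover have "\<exists>v. w = \<Psi> v" for w
      using orthogonal_transformation_surj[OF \<Psi>] by (auto simp: surj_def)
    ultimately show ?thesis by (auto simp: image_iff) metis
  qed
  moreover have "dim (\<Psi> ` S) = dim S" for S
    by (rule dim_image_eq[OF lin]) (meson \<Psi> inj_on_subset orthogonal_transformation_inj subset_UNIV)
  ultimately have card: "card {j. cos (\<theta> $ j) = u} = card {j. cos (\<theta>' $ j) = u}" for u
    by (metis dimE mult_left_cancel zero_neq_numeral)
  \<comment> \<open>Values taken equally often form equal multisets, and these are matched by a
    permutation of the indices.\<close>
  have mset: "image_mset (\<lambda>j. cos (\<theta> $ j)) (mset_set UNIV) = image_mset (\<lambda>j. cos (\<theta>' $ j)) (mset_set UNIV)"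
    by (rule multiset_eqI) (simp add: count_image_mset_eq_card_vimage card)
  obtain \<sigma> where "\<sigma> permutes UNIV" "\<forall>j\<in>UNIV. cos (\<theta> $ j) = cos (\<theta>' $ \<sigma> j)"
    by (rule image_mset_eq_implies_permutes[OF finite mset])
  then show thesis using that permutes_bij by blast
qed

text \<open>Half the rotation angles of the \<open>k\<close>-th power of the generator, since a
  rotor covers the rotation through twice its angles.\<close>

definition spin_angle :: "nat \<Rightarrow> int ^ 'm::finite \<Rightarrow> nat \<Rightarrow> real ^ 'm" where
  "spin_angle q s k = (\<chi> j. real k * real_of_int (s $ j) * pi / real q)"

lemma lens_generator_power:
  "(lens_generator q s ^^ k) v = block_rotation (2 *\<^sub>R spin_angle q s k) v"
proof -
  have "of_nat k *\<^sub>R (\<chi> j. 2 * pi * real_of_int (s $ j) / real q) = 2 *\<^sub>R spin_angle q s k"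
    by (simp add: vec_eq_iff spin_angle_def)
  then show ?thesis unfolding lens_generator_def block_rotation_power by simp
qed

lemma lens_generator_rotation: "lens_generator q s v = block_rotation (2 *\<^sub>R spin_angle q s 1) v"
  using lens_generator_power[of 1] by simp

lemma spin_power_rotor:
  "spin_power q s h k = (-1) powi (int k * (h + floor_sum q s)) *\<^sub>R rotor (spin_angle q s k)"
  by (simp add: spin_power_def rotor_def list_rotor_def plane_rotor_def cl_plane_def spin_angle_def)

lemma cos_rational_eq:
  fixes a b :: int
  assumes q: "q > 0" and eq: "cos (2 * (a * pi / real q)) = cos (2 * (b * pi / real q))"
  obtains e n :: int where "e \<in> {-1, 1}" "e * a = b + int q * n"
proof -
  obtain k :: int where "2 * (a * pi / real q) = 2 * (b * pi / real q) + 2 * k * pi \<or>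
      2 * (a * pi / real q) = - (2 * (b * pi / real q)) + 2 * k * pi"
    using eq unfolding cos_eq by (auto elim!: Ints_cases)
  then have "pi * a = pi * (b + real q * k) \<or> pi * a = pi * (- b + real q * k)"
    using q by (auto simp: field_simps)
  then have "real_of_int a = real_of_int (b + int q * k) \<or> real_of_int a = real_of_int (- b + int q * k)"
    by auto
  then have "a = b + int q * k \<or> a = - b + int q * k" by (simp only: of_int_eq_iff)
  then show thesis
    using that[of 1 k] that[of "-1" "- k"] by auto
qed

lemma sin_coprime_nonzero:
  assumes q: "q > 1" and a: "coprime a (int q)"
  shows "sin (real_of_int a * pi / real q) \<noteq> 0"
proof
  assume "sin (real_of_int a * pi / real q) = 0"
  then obtain i :: int where "real_of_int a * pi / real q = i * pi"
    by (auto simp: sin_zero_iff_int2)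
  then have "real_of_int a = real_of_int (i * int q)" using q by (simp add: field_simps)
  then have "int q dvd a" by (simp only: of_int_eq_iff) simp
  with a have "is_unit (int q)" by (metis coprime_common_divisor dvd_refl)
  then show False using q by simp
qed

text \<open>A zero of the cosine is a zero of the sine of the double angle, so \<open>q\<close>
  would divide \<open>2 * a\<close> and hence 2.\<close>

lemma cos_coprime_nonzero:
  assumes q: "q > 2" and a: "coprime a (int q)"
  shows "cos (real_of_int a * pi / real q) \<noteq> 0"
proof
  assume "cos (real_of_int a * pi / real q) = 0"
  then have "sin (2 * (real_of_int a * pi / real q)) = 0" by (simp only: sin_double)
  then obtain i :: int where "2 * (real_of_int a * pi / real q) = i * pi"
    by (auto simp: sin_zero_iff_int2)
  then have "real_of_int (2 * a) = real_of_int (i * int q)" using q by (simp add: field_simps)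
  then have "int q dvd 2 * a" by (simp only: of_int_eq_iff) simp
  with a have "int q dvd 2" by (simp add: coprime_commute coprime_dvd_mult_left_iff)
  then show False using q by (auto dest: zdvd_imp_le)
qed

text \<open>The meeting point of geometry and lattices. The quotients \<open>n j\<close> are
  recorded because the parity of their sum decides which spin structures and which lattices
  correspond.\<close>

definition angle_match ::
  "nat \<Rightarrow> int ^ 'm::finite \<Rightarrow> int ^ 'm \<Rightarrow> nat \<Rightarrow> ('m \<Rightarrow> 'm) \<Rightarrow> ('m \<Rightarrow> int) \<Rightarrow> ('m \<Rightarrow> int) \<Rightarrow> bool" where
  "angle_match q s s' k \<sigma> e n \<longleftrightarrow> bij \<sigma> \<and> (\<forall>j. e j \<in> {-1, 1}) \<and>
     (\<forall>j. e j * s $ j = int k * s' $ \<sigma> j + int q * n j)"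

lemma angle_matchD:
  assumes "angle_match q s s' k \<sigma> e n"
  shows "bij \<sigma>" "e j \<in> {-1, 1}" "e j * s $ j = int k * s' $ \<sigma> j + int q * n j"
  using assms by (auto simp: angle_match_def)

lemma angle_match_spin_angle:
  assumes q: "q > 0" and m: "angle_match q s s' k \<sigma> e n"
  shows "of_int (e j) * spin_angle q s 1 $ j = spin_angle q s' k $ \<sigma> j + pi * of_int (n j)"
proof -
  have "real_of_int (e j * s $ j) = real_of_int (int k * s' $ \<sigma> j + int q * n j)"
    using angle_matchD(3)[OF m] by simp
  then have "of_int (e j) * real_of_int (s $ j) = real k * real_of_int (s' $ \<sigma> j) + real q * of_int (n j)"
    by simp
  then have "of_int (e j) * real_of_int (s $ j) * pi / real q =
      (real k * real_of_int (s' $ \<sigma> j) + real q * of_int (n j)) * pi / real q"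
    by simp
  then show ?thesis using q by (simp add: spin_angle_def field_simps)
qed

text \<open>For \<open>q > 2\<close> the sines and cosines are nonzero and
  \<open>det_intertwiner\<close> applies. Modulo 1 or 2 a number equals its negative, so there the
  signs may be replaced by others with the right product.\<close>

lemma lens_intertwiner_match:
  fixes s s' :: "int ^ 'm::{finite,linorder}"
  assumes q: "q > 0" and s: "\<And>j. coprime (s $ j) (int q)"
    and \<Psi>: "orthogonal_transformation \<Psi>"
    and int: "\<And>v. \<Psi> (lens_generator q s v) = (lens_generator q s' ^^ k) (\<Psi> v)"
  obtains \<sigma> e n where "angle_match q s s' k \<sigma> e n" "det (matrix \<Psi>) = of_int (\<Prod>j\<in>UNIV. e j)"
proof -
  note int = int[unfolded lens_generator_power lens_generator_rotation]
  obtain \<sigma> where \<sigma>: "bij \<sigma>"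
    and cos: "\<And>j. cos ((2 *\<^sub>R spin_angle q s 1) $ j) = cos ((2 *\<^sub>R spin_angle q s' k) $ \<sigma> j)"
    using block_rotation_conjugate_cos[OF \<Psi> int] by blast
  have "\<exists>e n. e \<in> {-1, 1} \<and> e * s $ j = int k * s' $ \<sigma> j + int q * n" for j
  proof -
    have "cos (2 * (real_of_int (s $ j) * pi / real q)) =
        cos (2 * (real_of_int (int k * s' $ \<sigma> j) * pi / real q))"
      using cos[of j] by (simp add: spin_angle_def)
    from cos_rational_eq[OF q this] show ?thesis by metis
  qed
  then obtain e n where en: "\<And>j. e j \<in> {-1, 1}" "\<And>j. e j * s $ j = int k * s' $ \<sigma> j + int q * n j"
    by metis
  have m: "angle_match q s s' k \<sigma> e n" using \<sigma> en by (simp add: angle_match_def)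
  show thesis
  proof (cases "q > 2")
    case True
    have "det (matrix \<Psi>) = of_int (\<Prod>j\<in>UNIV. e j)"
      by (rule det_intertwiner[OF \<Psi> int \<sigma> en(1) angle_match_spin_angle[OF q m]])
         (use True s in \<open>simp_all add: spin_angle_def sin_coprime_nonzero cos_coprime_nonzero\<close>)
    with m show thesis by (rule that)
  next
    case False
    have "\<bar>det (matrix \<Psi>)\<bar> = 1" using \<Psi> by (rule orthogonal_transformation_det)
    then obtain d :: int where d: "det (matrix \<Psi>) = of_int d" "d \<in> {-1, 1}"
      by (metis abs_eq_iff' insertCI of_int_1 of_int_minus)
    fix i :: 'm
    \<comment> \<open>The whole sign is put at a single index, so that the product is
      \<open>d\<close>.\<close>
    define e' where "e' j = (if j = i then d else 1)" for j
    have e': "e' j \<in> {-1, 1}" for j using d(2) by (simp add: e'_def)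
    have "int q dvd e' j - e j" for j
    proof -
      have "int q = 1 \<or> int q = 2" using False q by auto
      moreover have "2 dvd e' j - e j" using e'[of j] en(1)[of j] by auto
      ultimately show ?thesis by auto
    qed
    then obtain c where c: "\<And>j. e' j - e j = int q * c j" unfolding dvd_def by metis
    \<comment> \<open>The change of sign is a multiple of \<open>q\<close> and is absorbed into
      \<open>n\<close>.\<close>
    have "e' j * s $ j = int k * s' $ \<sigma> j + int q * (n j + c j * s $ j)" for j
    proof -
      have "e' j * s $ j = e j * s $ j + (e' j - e j) * s $ j" by (simp add: algebra_simps)
      then show ?thesis unfolding en(2) c by (simp add: algebra_simps)
    qed
    then have "angle_match q s s' k \<sigma> e' (\<lambda>j. n j + c j * s $ j)"
      using \<sigma> e' by (simp add: angle_match_def)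
    moreover have "(\<Prod>j\<in>UNIV. e' j) = d" unfolding e'_def by simp
    ultimately show thesis using that d(1) by metis
  qed
qed

lemma lens_lift_intertwines:
  assumes "lens_lift q s s' \<psi> \<Psi>"
  obtains k where "\<Psi> \<circ> lens_generator q s \<circ> inv \<Psi> = lens_generator q s' ^^ k"
    "\<And>v. \<Psi> (lens_generator q s v) = (lens_generator q s' ^^ k) (\<Psi> v)"
proof -
  have \<Psi>: "orthogonal_transformation \<Psi>"
    and \<Gamma>: "(\<lambda>g. \<Psi> \<circ> g \<circ> inv \<Psi>) ` lens_group q s = lens_group q s'"
    using assms by (auto simp: lens_lift_def)
  have "lens_generator q s \<in> lens_group q s"
    unfolding lens_group_def by (rule range_eqI[of _ _ 1]) simp
  with \<Gamma> have "\<Psi> \<circ> lens_generator q s \<circ> inv \<Psi> \<in> lens_group q s'" by blast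
  then obtain k where k: "\<Psi> \<circ> lens_generator q s \<circ> inv \<Psi> = lens_generator q s' ^^ k"
    by (auto simp: lens_group_def)
  moreover have "\<Psi> (lens_generator q s v) = (lens_generator q s' ^^ k) (\<Psi> v)" for v
    unfolding k[symmetric] using orthogonal_transformation_inj[OF \<Psi>] by simp
  ultimately show thesis by (rule that)
qed

text \<open>Two lifts differ by an element of the group, since countably many proper subspaces do not
  cover the whole space; and every element of the group is the square of a block rotation.\<close>

lemma lens_lift_det_eq:
  fixes s s' :: "int ^ 'm::{finite,linorder}"
  assumes "lens_lift q s s' \<psi> \<Psi>" "lens_lift q s s' \<psi> \<Phi>"
  shows "det (matrix \<Phi>) = det (matrix \<Psi>)"
proof -
  have o: "orthogonal_transformation \<Psi>" "orthogonal_transformation \<Phi>"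
    using assms by (auto simp: lens_lift_def)
  then have lin: "linear \<Psi>" "linear \<Phi>" by (auto simp: orthogonal_transformation_linear)
  let ?g = "\<lambda>k. block_rotation (2 *\<^sub>R spin_angle q s' k)"
  define S where "S k = {x. \<Phi> x = ?g k (\<Psi> x)}" for k
  have sub: "subspace (S k)" for k
    by (rule subspaceI) (simp_all add: S_def linear_0[OF lin(1)] linear_0[OF lin(2)]
      linear_add[OF lin(1)] linear_add[OF lin(2)] linear_scale[OF lin(1)] linear_scale[OF lin(2)]
      linear_0[OF block_rotation_linear] linear_add[OF block_rotation_linear]
      linear_scale[OF block_rotation_linear])
  have "x \<in> (\<Union>k. S k)" for x
  proof (cases "x = 0")
    case True
    then show ?thesis using subspace_0[OF sub] by auto
  next
    case False
    \<comment> \<open>A lift describes \<open>\<psi>\<close> on the unit sphere, so \<open>x\<close>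
      is normalised first; membership in the subspace \<open>S k\<close> then scales back.\<close>
    let ?y = "x /\<^sub>R norm x"
    have "?y \<in> sphere 0 1" using False by simp
    then have "lens_orbit q s' (\<Phi> ?y) = lens_orbit q s' (\<Psi> ?y)"
      using assms by (simp add: lens_lift_def)
    moreover have "\<Phi> ?y \<in> lens_orbit q s' (\<Phi> ?y)"
      unfolding lens_orbit_def lens_group_def by (auto intro!: exI[of _ id] range_eqI[of _ _ 0])
    ultimately have "\<Phi> ?y \<in> lens_orbit q s' (\<Psi> ?y)" by simp
    then obtain k where "?y \<in> S k"
      by (auto simp: lens_orbit_def lens_group_def S_def lens_generator_power)
    then have "norm x *\<^sub>R ?y \<in> S k" by (rule subspace_scale[OF sub])
    then show ?thesis using False by auto
  qed
  then have "\<not> negligible (\<Union>k. S k)" by (metis UNIV_eq_I non_negligible_UNIV)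
  then obtain k where "\<not> negligible (S k)" using negligible_Union_nat by blast
  then have "\<not> dim (S k) < DIM(real ^ ('m \<times> bool))" using negligible_lowdim by blast
  then have "dim (S k) = DIM(real ^ ('m \<times> bool))" using dim_subset_UNIV[of "S k"] by linarith
  then have "S k = UNIV" using dim_eq_full[of "S k"] sub by (metis span_eq_iff)
  then have \<Phi>: "\<Phi> = ?g k \<circ> \<Psi>" by (auto simp: S_def set_eq_iff fun_eq_iff)
  let ?r = "block_rotation (spin_angle q s' k)"
  have "?g k = ?r \<circ> ?r" by (auto simp: fun_eq_iff block_rotation_add scaleR_2)
  then have "det (matrix \<Phi>) = det (matrix ?r) * det (matrix ?r) * det (matrix \<Psi>)"
    unfolding \<Phi> by (simp only: matrix_compose lin block_rotation_linear linear_compose det_mul)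
  moreover have "\<bar>det (matrix \<Phi>)\<bar> = 1" "\<bar>det (matrix \<Psi>)\<bar> = 1"
    using o by (auto simp: orthogonal_transformation_det)
  ultimately show ?thesis
    by (smt (verit) mult_minus_right zero_le_square mult_cancel_left2)
qed

text \<open>A common divisor of \<open>k\<close> and \<open>q\<close> would also divide
  \<open>s $ j\<close>. Hence the \<open>k\<close>-th power of the generator generates the whole
  group, and \<open>k\<close> is odd if \<open>q\<close> is even.\<close>

lemma angle_match_coprime:
  fixes s :: "int ^ 'm::finite"
  assumes m: "angle_match q s s' k \<sigma> e n" and s: "\<And>j. coprime (s $ j) (int q)"
  shows "coprime (int k) (int q)"
proof (rule coprimeI)
  fix c assume c: "c dvd int k" "c dvd int q"
  fix j :: 'm
  have "c dvd e j * s $ j" unfolding angle_matchD(3)[OF m] using c by simp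
  then have "c dvd s $ j" using angle_matchD(2)[OF m, of j] by auto
  then show "is_unit c" using c(2) s[of j] coprime_common_divisor by blast
qed

section \<open>Spin structures under conjugation\<close>

lemma spin_power_add: "spin_power q s h (k + l) = spin_power q s h k * spin_power q s h l"
proof -
  have "spin_angle q s (k + l) = spin_angle q s k + spin_angle q s l"
    by (simp add: vec_eq_iff spin_angle_def algebra_simps add_divide_distrib)
  then show ?thesis
    unfolding spin_power_rotor by (simp add: rotor_add power_int_add distrib_right)
qed

text \<open>Both sides are signs times the same rotor, so the equation compares two parities. As
  \<open>k\<close> is coprime to the even \<open>q\<close>, it is odd and drops out of the exponent
  in \<open>spin_power\<close>.\<close>

lemma spin_structure_conjugate_iff:
  fixes s s' :: "int ^ 'm::{finite,linorder}"
  assumes q: "q > 0" "even q" and m: "even CARD('m)"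
    and s: "\<And>j. coprime (s $ j) (int q)" and s': "\<And>j. coprime (s' $ j) (int q)"
    and x: "pin_lift x \<Psi>" and \<Psi>: "orthogonal_transformation \<Psi>"
    and int: "\<And>v. \<Psi> (lens_generator q s v) = (lens_generator q s' ^^ k) (\<Psi> v)"
    and match: "angle_match q s s' k \<sigma> e n" and det: "det (matrix \<Psi>) = of_int (\<Prod>j\<in>UNIV. e j)"
  shows "spin_structure q s' h' (lens_generator q s' ^^ k) =
      x * spin_structure q s h (lens_generator q s) * cl_inverse x \<longleftrightarrow>
    even (h' + floor_sum q s' + (h + floor_sum q s) + (\<Sum>j\<in>UNIV. n j))"
proof -
  let ?R = "rotor (spin_angle q s' k)" and ?N = "\<Sum>j\<in>UNIV. n j"
  have "q > 1" using q by (cases "q = 1") auto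
  then have "x * rotor (spin_angle q s 1) * cl_inverse x = (-1) powi ?N *\<^sub>R ?R"
    using int s by (intro pin_conjugate_rotor_match[OF x \<Psi> _ angle_matchD(1,2)[OF match]
          angle_match_spin_angle[OF q(1) match] _ det])
      (simp_all add: lens_generator_power lens_generator_rotation spin_angle_def sin_coprime_nonzero)
  then have "x * spin_structure q s h (lens_generator q s) * cl_inverse x
      = ((-1) powi (h + floor_sum q s) * (-1) powi ?N) *\<^sub>R ?R"
    using spin_structure_power[OF q m s, of h 1] by (simp add: spin_power_rotor)
  moreover have "spin_structure q s' h' (lens_generator q s' ^^ k)
      = (-1) powi (int k * (h' + floor_sum q s')) *\<^sub>R ?R"
    by (simp only: spin_structure_power[OF q m s'] spin_power_rotor)
  \<comment> \<open>A rotor is invertible, hence nonzero, so the sign factors in front of it can be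
    compared.\<close>
  moreover have "?R \<noteq> 0"
  proof
    assume "?R = 0"
    then have "?R * rotor (- spin_angle q s' k) = 0" by simp
    then show False by (simp add: rotor_add)
  qed
  moreover have "odd k"
    using angle_match_coprime[OF match s] q(2) by (metis coprime_common_divisor even_of_nat odd_one)
  ultimately show ?thesis
    by (auto simp: power_int_minus_left)
qed

text \<open>Both sides are multiplicative in the exponent, so the spin condition passes from the
  generator to the whole group.\<close>

lemma spin_power_conjugate:
  fixes s s' :: "int ^ 'm::{finite,linorder}"
  assumes x: "pin_lift x \<Psi>"
    and k: "spin_power q s' h' k = x * spin_power q s h 1 * cl_inverse x"
  shows "spin_power q s' h' (k * l) = x * spin_power q s h l * cl_inverse x"
proof (induction l)
  have zero: "spin_power q s h 0 = 1" for s :: "int ^ 'm::{finite,linorder}" and h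
  proof -
    have "spin_angle q s 0 = 0" by (simp add: vec_eq_iff spin_angle_def)
    then show ?thesis by (simp add: spin_power_rotor)
  qed
  have inv: "x * cl_inverse x = 1" "cl_inverse x * x = 1" using pin_liftE[OF x] by metis+
  case 0
  show ?case by (simp add: zero inv)
  case (Suc l)
  have "spin_power q s' h' (k * Suc l) = x * spin_power q s h 1 * (cl_inverse x * x) * spin_power q s h l * cl_inverse x"
    by (simp add: spin_power_add k Suc mult.assoc)
  then show ?case
    using spin_power_add[of q s h 1 l] by (simp add: inv mult.assoc)
qed

section \<open>From intertwiners to isometries\<close>

lemma lens_generator_power_cong:
  assumes q: "q > 0" and kl: "[k = l] (mod q)"
  shows "lens_generator q s ^^ k = lens_generator q s ^^ l"
proof -
  have "(lens_generator q s ^^ q) v = v" for v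
  proof -
    have "cos (2 * (of_int (s $ j) * pi)) = 1" "sin (2 * (of_int (s $ j) * pi)) = 0" for j
      using cos_int_2pin[of "s $ j"] sin_int_2pin[of "s $ j"] by (simp_all add: mult_ac)
    then show ?thesis
      using q unfolding lens_generator_power
      by (auto simp: block_rotation_def spin_angle_def vec_eq_iff)
  qed
  then have "lens_generator q s ^^ q = id" by auto
  then have "lens_generator q s ^^ k = lens_generator q s ^^ (k mod q)" for k
    by (metis funpow_mod_eq id_apply fun_eq_iff ext)
  then show ?thesis using kl unfolding cong_def by metis
qed

lemma intertwiner_lens_isometry:
  fixes s s' :: "int ^ 'm::finite"
  assumes q: "q > 0" and k: "coprime k q" and \<Psi>: "orthogonal_transformation \<Psi>"
    and int: "\<And>v. \<Psi> (lens_generator q s v) = (lens_generator q s' ^^ k) (\<Psi> v)"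
  shows "lens_isometry q s s' (image \<Psi>)" "lens_lift q s s' (image \<Psi>) \<Psi>"
    and "\<Psi> \<circ> (lens_generator q s ^^ l) \<circ> inv \<Psi> = lens_generator q s' ^^ (k * l)"
proof -
  let ?g = "lens_generator q s" and ?g' = "lens_generator q s'"
  have surj: "surj \<Psi>" and inj: "inj \<Psi>"
    using \<Psi> by (auto simp: orthogonal_transformation_surj orthogonal_transformation_inj)
  have pow: "\<Psi> ((?g ^^ l) v) = (?g' ^^ (k * l)) (\<Psi> v)" for l v
    by (induction l) (simp_all add: int funpow_add)
  show conj: "\<Psi> \<circ> (?g ^^ l) \<circ> inv \<Psi> = ?g' ^^ (k * l)" for l
    by (simp add: fun_eq_iff pow surj_f_inv_f[OF surj])
  \<comment> \<open>\<open>c\<close> inverts \<open>k\<close> modulo \<open>q\<close>: every power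
    of \<open>?g'\<close> is a power of \<open>?g' ^^ k\<close>, so groups and orbits are mapped
    onto, not merely into, their counterparts.\<close>
  obtain c where "[k * c = 1] (mod q)" using k cong_solve_coprime_nat by auto
  then have "[k * (c * l) = l] (mod q)" for l
    using cong_mult[of "k * c" 1 q l l] by (simp add: mult.assoc)
  then have c: "?g' ^^ (k * (c * l)) = ?g' ^^ l" for l
    by (rule lens_generator_power_cong[OF q])
  have group: "(\<lambda>g. \<Psi> \<circ> g \<circ> inv \<Psi>) ` lens_group q s = lens_group q s'"
  proof -
    have "?g' ^^ l \<in> (\<lambda>g. \<Psi> \<circ> g \<circ> inv \<Psi>) ` lens_group q s" for l
      unfolding c[of l, symmetric] conj[symmetric] by (auto simp: lens_group_def)
    then show ?thesis by (auto simp: lens_group_def conj)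
  qed
  have orbit: "\<Psi> ` lens_orbit q s x = lens_orbit q s' (\<Psi> x)" for x
  proof -
    have "(?g' ^^ l) (\<Psi> x) \<in> \<Psi> ` lens_orbit q s x" for l
      unfolding c[of l, symmetric] pow[symmetric] by (auto simp: lens_group_def lens_orbit_def)
    then show ?thesis by (auto simp: lens_group_def lens_orbit_def pow)
  qed
  show "lens_lift q s s' (image \<Psi>) \<Psi>"
    using \<Psi> group orbit by (simp add: lens_lift_def)
  have "\<Psi> ` sphere 0 1 = sphere 0 1"
  proof -
    have "v \<in> \<Psi> ` sphere 0 1" if "norm v = 1" for v
      using that surj orthogonal_transformation_norm[OF \<Psi>] by (metis imageI mem_sphere_0 surjD)
    then show ?thesis using orthogonal_transformation_norm[OF \<Psi>] by auto
  qed
  then have "image \<Psi> ` lens_space q s = lens_space q s'"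
    unfolding lens_space_def image_image orbit by (metis image_image)
  moreover have "inj_on (image \<Psi>) (lens_space q s)"
    using inj by (auto simp: inj_on_def inj_image_eq_iff)
  moreover have "lens_dist (\<Psi> ` X) (\<Psi> ` Y) = lens_dist X Y" for X Y
  proof -
    have "\<Psi> v \<bullet> \<Psi> w = v \<bullet> w" for v w
      using \<Psi> by (simp add: orthogonal_transformation_def)
    moreover have "{arccos (x \<bullet> y) | x y. x \<in> \<Psi> ` X \<and> y \<in> \<Psi> ` Y} =
        {arccos (\<Psi> v \<bullet> \<Psi> w) | v w. v \<in> X \<and> w \<in> Y}"
      by blast
    ultimately show ?thesis by (simp add: lens_dist_def)
  qed
  ultimately show "lens_isometry q s s' (image \<Psi>)"
    by (simp add: lens_isometry_def bij_betw_def)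
qed

lemma block_permutation_intertwines:
  assumes q: "q > 0" and match: "angle_match q s s' k \<sigma> e n"
  shows "block_permutation \<sigma> e (lens_generator q s v) =
    (lens_generator q s' ^^ k) (block_permutation \<sigma> e v)"
  unfolding lens_generator_power lens_generator_rotation
proof (rule block_permutation_rotation[OF angle_matchD(1,2)[OF match]])
  show "of_int (e j) * (2 *\<^sub>R spin_angle q s 1) $ j =
      (2 *\<^sub>R spin_angle q s' k) $ \<sigma> j + 2 * pi * of_int (n j)" for j
    using angle_match_spin_angle[OF q match, of j] by simp
qed

section \<open>Lattices\<close>

text \<open>The map of \<open>oriented_l1_isometry\<close> on odd numerators, with the common
  denominator 2 cleared.\<close>

definition signed_permutation ::
  "('m::finite \<Rightarrow> 'm) \<Rightarrow> ('m \<Rightarrow> int) \<Rightarrow> int ^ 'm \<Rightarrow> int ^ 'm" where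
  "signed_permutation \<sigma> e a = (\<chi> i. e (inv \<sigma> i) * a $ inv \<sigma> i)"

lemma odd_signed_permutation:
  assumes "\<And>j. e j \<in> {-1, 1}" "\<forall>j. odd (a $ j)"
  shows "\<forall>j. odd (signed_permutation \<sigma> e a $ j)"
proof
  fix j
  show "odd (signed_permutation \<sigma> e a $ j)"
    using assms(1)[of "inv \<sigma> j"] assms(2) by (auto simp: signed_permutation_def)
qed

text \<open>A signed permutation is a bijection of the odd vectors, so equality of images is a
  pointwise equivalence of the conditions. Arbitrary \<open>C\<close> and \<open>C'\<close> let this
  serve both kinds of lattices.\<close>

lemma l1_isometry_image_eq_iff:
  fixes C C' :: "int ^ 'm::finite \<Rightarrow> bool"
  assumes \<sigma>: "bij \<sigma>" and e: "\<And>j. e j \<in> {-1, 1}"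
    and \<phi>: "\<forall>x\<in>half_odd_vectors. \<phi> x = (\<chi> i. of_int (e (inv \<sigma> i)) * x $ inv \<sigma> i)"
  shows "\<phi> ` {(\<chi> j. real_of_int (a $ j) / 2) | a. (\<forall>j. odd (a $ j)) \<and> C a} =
      {(\<chi> j. real_of_int (a $ j) / 2) | a. (\<forall>j. odd (a $ j)) \<and> C' a} \<longleftrightarrow>
    (\<forall>a. (\<forall>j. odd (a $ j)) \<longrightarrow> (C a \<longleftrightarrow> C' (signed_permutation \<sigma> e a)))"
proof -
  define half :: "int ^ 'm \<Rightarrow> real ^ 'm" where "half a = (\<chi> j. real_of_int (a $ j) / 2)" for a
  have half_inj: "half a = half b \<longleftrightarrow> a = b" for a b by (auto simp: half_def vec_eq_iff)
  let ?p = "signed_permutation \<sigma> e"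
  have \<phi>: "\<phi> (half a) = half (?p a)" if "\<forall>j. odd (a $ j)" for a
  proof -
    have "half a \<in> half_odd_vectors" using that by (auto simp: half_odd_vectors_def half_def)
    then show ?thesis using \<phi> by (simp add: half_def signed_permutation_def vec_eq_iff)
  qed
  have ee: "e j * (e j * y) = y" for j y using e[of j] by auto
  have inj: "?p a = ?p b \<longleftrightarrow> a = b" for a b
  proof
    assume "?p a = ?p b"
    then have "?p a $ \<sigma> j = ?p b $ \<sigma> j" for j by simp
    then have "e j * (e j * a $ j) = e j * (e j * b $ j)" for j
      using \<sigma> by (simp add: signed_permutation_def bij_is_inj)
    then show "a = b" by (simp add: ee vec_eq_iff)
  qed simp
  have surj: "\<exists>a. (\<forall>j. odd (a $ j)) \<and> b = ?p a" if "\<forall>j. odd (b $ j)" for b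
  proof (intro exI conjI)
    have "odd (e j)" for j using e[of j] by auto
    then show "\<forall>j. odd ((\<chi> j. e j * b $ \<sigma> j) $ j)" using that by simp
    show "b = ?p (\<chi> j. e j * b $ \<sigma> j)"
      using \<sigma> by (simp add: signed_permutation_def vec_eq_iff ee bij_is_surj surj_f_inv_f)
  qed
  have "\<phi> ` {half a | a. (\<forall>j. odd (a $ j)) \<and> C a} = half ` ?p ` {a. (\<forall>j. odd (a $ j)) \<and> C a}"
  proof -
    have "\<phi> ` {half a | a. (\<forall>j. odd (a $ j)) \<and> C a} = (\<lambda>a. \<phi> (half a)) ` {a. (\<forall>j. odd (a $ j)) \<and> C a}"
      by auto
    also have "\<dots> = (\<lambda>a. half (?p a)) ` {a. (\<forall>j. odd (a $ j)) \<and> C a}"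
      using \<phi> by (intro image_cong) auto
    finally show ?thesis by (simp only: image_image)
  qed
  moreover have "{half a | a. (\<forall>j. odd (a $ j)) \<and> C' a} = half ` {a. (\<forall>j. odd (a $ j)) \<and> C' a}"
    by auto
  moreover have "half ` ?p ` {a. (\<forall>j. odd (a $ j)) \<and> C a} = half ` {a. (\<forall>j. odd (a $ j)) \<and> C' a} \<longleftrightarrow>
      ?p ` {a. (\<forall>j. odd (a $ j)) \<and> C a} = {a. (\<forall>j. odd (a $ j)) \<and> C' a}"
    using half_inj by (intro inj_image_eq_iff injI) blast
  moreover have "\<dots> \<longleftrightarrow> (\<forall>a. (\<forall>j. odd (a $ j)) \<longrightarrow> (C a \<longleftrightarrow> C' (?p a)))"
  proof
    assume eq: "?p ` {a. (\<forall>j. odd (a $ j)) \<and> C a} = {a. (\<forall>j. odd (a $ j)) \<and> C' a}"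
    show "\<forall>a. (\<forall>j. odd (a $ j)) \<longrightarrow> (C a \<longleftrightarrow> C' (?p a))"
    proof (intro allI impI)
      fix a :: "int ^ 'm" assume a: "\<forall>j. odd (a $ j)"
      have "C' (?p a) \<longleftrightarrow> ?p a \<in> ?p ` {a. (\<forall>j. odd (a $ j)) \<and> C a}"
        unfolding eq using odd_signed_permutation[of e a \<sigma>, OF e a] by blast
      also have "\<dots> \<longleftrightarrow> C a" using a inj by (simp add: inj_image_mem_iff inj_def)
      finally show "C a \<longleftrightarrow> C' (?p a)" by simp
    qed
  next
    assume C: "\<forall>a. (\<forall>j. odd (a $ j)) \<longrightarrow> (C a \<longleftrightarrow> C' (?p a))"
    show "?p ` {a. (\<forall>j. odd (a $ j)) \<and> C a} = {a. (\<forall>j. odd (a $ j)) \<and> C' a}"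
    proof (intro equalityI subsetI)
      fix b assume "b \<in> {a. (\<forall>j. odd (a $ j)) \<and> C' a}"
      then show "b \<in> ?p ` {a. (\<forall>j. odd (a $ j)) \<and> C a}" using surj[of b] C by blast
    next
      fix b assume "b \<in> ?p ` {a. (\<forall>j. odd (a $ j)) \<and> C a}"
      then obtain a where "b = ?p a" "\<forall>j. odd (a $ j)" "C a" by blast
      then show "b \<in> {a. (\<forall>j. odd (a $ j)) \<and> C' a}"
        using odd_signed_permutation[of e a \<sigma>, OF e] C by blast
    qed
  qed
  ultimately show ?thesis unfolding half_def by (simp only:)
qed

lemma signed_permutation_dot:
  assumes "bij \<sigma>"
  shows "(\<Sum>i\<in>UNIV. signed_permutation \<sigma> e a $ i * s $ i) = (\<Sum>j\<in>UNIV. e j * a $ j * s $ \<sigma> j)"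
  using sum.reindex_bij_betw[OF assms, of "\<lambda>i. signed_permutation \<sigma> e a $ i * s $ i"] assms
  by (simp add: signed_permutation_def bij_is_inj)

text \<open>As \<open>e j\<close> squares to 1, the sign leaves the main term and the rest is a
  multiple of \<open>q\<close>. It vanishes modulo \<open>q\<close>, but modulo \<open>2 * q\<close>
  the parity of its cofactor counts.\<close>

lemma angle_match_dot:
  assumes match: "angle_match q s s' k \<sigma> e n"
  shows "int k * (\<Sum>i\<in>UNIV. signed_permutation \<sigma> e a $ i * s' $ i) =
    (\<Sum>j\<in>UNIV. a $ j * s $ j) - int q * (\<Sum>j\<in>UNIV. e j * a $ j * n j)"
proof -
  have "int k * (e j * a $ j * s' $ \<sigma> j) = a $ j * s $ j - int q * (e j * a $ j * n j)" for j
  proof -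
    have "int k * (e j * a $ j * s' $ \<sigma> j) = e j * a $ j * (e j * s $ j - int q * n j)"
      unfolding angle_matchD(3)[OF match] by (simp add: algebra_simps)
    also have "\<dots> = (e j * e j) * a $ j * s $ j - int q * (e j * a $ j * n j)"
      by (simp add: algebra_simps)
    finally show ?thesis using angle_matchD(2)[OF match, of j] by auto
  qed
  then show ?thesis
    unfolding signed_permutation_dot[OF angle_matchD(1)[OF match]]
    by (simp add: sum_distrib_left sum_subtractf)
qed

lemma angle_match_lens_lattice:
  assumes match: "angle_match q s s' k \<sigma> e n" and s: "\<And>j. coprime (s $ j) (int q)"
  shows "[(\<Sum>j\<in>UNIV. a $ j * s $ j) = 0] (mod int q) \<longleftrightarrow>
    [(\<Sum>j\<in>UNIV. signed_permutation \<sigma> e a $ j * s' $ j) = 0] (mod int q)"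
proof -
  let ?S = "\<Sum>j\<in>UNIV. signed_permutation \<sigma> e a $ j * s' $ j"
  have "int q dvd ?S \<longleftrightarrow> int q dvd int k * ?S"
    using angle_match_coprime[OF match s] by (simp add: coprime_dvd_mult_right_iff coprime_commute)
  also have "\<dots> \<longleftrightarrow> int q dvd (\<Sum>j\<in>UNIV. a $ j * s $ j)"
    unfolding angle_match_dot[OF match] by (simp add: dvd_diff_left_iff)
  finally show ?thesis by (simp add: cong_0_iff)
qed

text \<open>Since \<open>e j * a $ j\<close> is odd, the correction in
  \<open>angle_match_dot\<close> is \<open>q\<close> times a number with the parity of the sum of
  the \<open>n j\<close>. Being odd and coprime to \<open>q\<close>, \<open>k\<close> is invertible
  modulo \<open>2 * q\<close> and can be cancelled.\<close>

lemma angle_match_spin_lattice: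
  assumes q: "even q" and match: "angle_match q s s' k \<sigma> e n" and s: "\<And>j. coprime (s $ j) (int q)"
    and a: "\<forall>j. odd (a $ j)"
  shows "[(\<Sum>j\<in>UNIV. a $ j * s $ j) = h * int q] (mod (2 * int q)) \<longleftrightarrow>
    [(\<Sum>j\<in>UNIV. signed_permutation \<sigma> e a $ j * s' $ j) = (h - (\<Sum>j\<in>UNIV. n j)) * int q]
      (mod (2 * int q))"
proof -
  let ?S = "\<Sum>j\<in>UNIV. signed_permutation \<sigma> e a $ j * s' $ j" and ?N = "\<Sum>j\<in>UNIV. n j"
    and ?T = "\<Sum>j\<in>UNIV. a $ j * s $ j" and ?E = "\<Sum>j\<in>UNIV. e j * a $ j * n j"
  have cop: "coprime (int k) (int q)" using angle_match_coprime[OF match s] .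
  have "odd (int k)" using cop q by (metis coprime_common_divisor even_of_nat odd_one)
  with cop have cop2: "coprime (2 * int q) (int k)"
    by (simp add: coprime_commute)
  have "even (e j * a $ j * n j - n j)" for j
    using a angle_matchD(2)[OF match, of j] by auto
  then have "even (\<Sum>j\<in>UNIV. e j * a $ j * n j - n j)" by (intro dvd_sum) auto
  then have "even (?E - ?N)" by (simp add: sum_subtractf)
  \<comment> \<open>The cofactor of \<open>q\<close> that is left over when the congruence for
    \<open>?S\<close> is multiplied by \<open>k\<close>.\<close>
  then have "even (h * (1 - int k) + ?N * int k - ?E)"
    using \<open>odd (int k)\<close> by auto
  then have even: "2 * int q dvd int q * (h * (1 - int k) + ?N * int k - ?E)"
    by (simp add: mult.commute mult_dvd_mono)
  have "2 * int q dvd ?S - (h - ?N) * int q \<longleftrightarrow> 2 * int q dvd int k * (?S - (h - ?N) * int q)"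
    using cop2 by (simp add: coprime_dvd_mult_right_iff)
  also have "int k * (?S - (h - ?N) * int q) =
      (?T - h * int q) + int q * (h * (1 - int k) + ?N * int k - ?E)"
    unfolding right_diff_distrib[of "int k" ?S] angle_match_dot[OF match] by (simp add: algebra_simps)
  also have "2 * int q dvd \<dots> \<longleftrightarrow> 2 * int q dvd ?T - h * int q"
    using even by (rule dvd_add_left_iff)
  finally show ?thesis by (simp add: cong_iff_dvd_diff)
qed

text \<open>Provides the point from which \<open>lattice_isometry_angle_match\<close> moves. All
  entries are 1 except one, which solves the congruence.\<close>

lemma odd_orthogonal_vector_exists:
  fixes s :: "int ^ 'm::finite"
  assumes s: "\<And>j. coprime (s $ j) (int q)" and m: "odd q \<or> even CARD('m)"
  shows "\<exists>a :: int ^ 'm. (\<forall>j. odd (a $ j)) \<and> int q dvd (\<Sum>j\<in>UNIV. a $ j * s $ j)"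
proof -
  fix i :: 'm
  let ?R = "\<Sum>j\<in>UNIV - {i}. s $ j"
  obtain u where "[s $ i * u = 1] (mod int q)" using cong_solve_coprime_int[OF s] by blast
  then have u: "int q dvd s $ i * u - 1" by (simp add: cong_iff_dvd_diff)
  \<comment> \<open>\<open>- (u * ?R)\<close> solves the congruence. For odd \<open>q\<close>,
    adding \<open>q\<close> corrects its parity if necessary; for even \<open>q\<close> it is odd
    already, because \<open>u\<close> is odd and \<open>?R\<close> is a sum of an odd number of odd
    terms.\<close>
  define c where "c = (if odd (u * ?R) then - (u * ?R) else int q - u * ?R)"
  have "odd c"
  proof (cases "odd q")
    case True
    then show ?thesis by (auto simp: c_def)
  next
    case False
    then have odd_s: "odd (s $ j)" for j
      using s[of j] by (metis coprime_common_divisor even_of_nat odd_one)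
    have "even (\<Sum>j\<in>UNIV. s $ j)" using m False odd_s by (simp add: even_sum_iff)
    moreover have "(\<Sum>j\<in>UNIV. s $ j) = s $ i + ?R" by (simp add: sum.remove)
    ultimately have "odd ?R" using odd_s[of i] by presburger
    moreover have "odd u"
    proof
      assume "even u"
      moreover have "even (s $ i * u - 1)" using u False by (meson dvd_trans even_of_nat)
      ultimately show False by simp
    qed
    ultimately show ?thesis by (simp add: c_def)
  qed
  define a :: "int ^ 'm" where "a = (\<chi> j. if j = i then c else 1)"
  have "(\<Sum>j\<in>UNIV. a $ j * s $ j) = c * s $ i + (\<Sum>j\<in>UNIV - {i}. a $ j * s $ j)"
    by (subst sum.remove[of _ i]) (simp_all add: a_def)
  also have "(\<Sum>j\<in>UNIV - {i}. a $ j * s $ j) = ?R" by (intro sum.cong) (auto simp: a_def)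
  also have "c * s $ i + ?R = (if odd (u * ?R) then 0 else int q * s $ i) - ?R * (s $ i * u - 1)"
    by (simp add: c_def algebra_simps)
  finally have "int q dvd (\<Sum>j\<in>UNIV. a $ j * s $ j)" using u by (simp add: dvd_diff)
  moreover have "\<forall>j. odd (a $ j)" using \<open>odd c\<close> by (simp add: a_def)
  ultimately show ?thesis by blast
qed

text \<open>Moving along \<open>2 (e\<^sub>j - w e\<^sub>i)\<close> with \<open>w s\<^sub>i \<equiv> s\<^sub>j\<close> stays in the lattice of \<open>s\<close>; that the
  image stays in the lattice of \<open>s'\<close> says that the permuted \<open>s'\<close> is proportional to \<open>s\<close>.\<close>

lemma lattice_isometry_angle_match:
  fixes s s' :: "int ^ 'm::finite" and M :: int
  assumes q: "q > 0" and s: "\<And>j. coprime (s $ j) (int q)" and s': "\<And>j. coprime (s' $ j) (int q)"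
    and \<sigma>: "bij \<sigma>" and e: "\<And>j. e j \<in> {-1, 1}"
    and M: "\<And>z. M dvd 2 * z \<longleftrightarrow> int q dvd z" and a: "\<forall>j. odd (a $ j)"
    and lat: "\<And>b. \<forall>j. odd (b $ j) \<Longrightarrow>
      M dvd (\<Sum>j\<in>UNIV. b $ j * s $ j) - (\<Sum>j\<in>UNIV. a $ j * s $ j) \<Longrightarrow>
      M dvd (\<Sum>j\<in>UNIV. signed_permutation \<sigma> e b $ j * s' $ j) -
        (\<Sum>j\<in>UNIV. signed_permutation \<sigma> e a $ j * s' $ j)"
  obtains k n where "angle_match q s s' k \<sigma> e n"
proof -
  fix i :: 'm
  \<comment> \<open>\<open>s'\<close> pulled back along the signed permutation: its product with a
    permuted vector is that of \<open>t\<close> with the vector itself.\<close>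
  define t where "t j = e j * s' $ \<sigma> j" for j
  obtain u where "[s $ i * u = 1] (mod int q)" using cong_solve_coprime_int[OF s] by blast
  then have u: "int q dvd s $ i * u - 1" by (simp add: cong_iff_dvd_diff)
  have proportional: "int q dvd t j - u * t i * s $ j" for j
  proof -
    \<comment> \<open>Half the displacement, with \<open>u * s $ j\<close> as the multiplier
      \<open>w\<close>. Written as a difference, it needs no separate case for
      \<open>j = i\<close>.\<close>
    define d where "d l = (if l = j then 1 else 0) - (if l = i then u * s $ j else 0)" for l
    define b where "b = (\<chi> l. a $ l + 2 * d l)"
    have dsum: "(\<Sum>l\<in>UNIV. d l * f l) = f j - u * s $ j * f i" for f :: "'m \<Rightarrow> int"
    proof -
      have "(\<Sum>l\<in>UNIV. d l * f l) =
          (\<Sum>l\<in>UNIV. if l = j then f l else 0) - (\<Sum>l\<in>UNIV. if l = i then u * s $ j * f l else 0)"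
        unfolding sum_subtractf[symmetric] by (intro sum.cong) (simp_all add: d_def left_diff_distrib)
      then show ?thesis by simp
    qed
    have "(\<Sum>l\<in>UNIV. b $ l * s $ l) - (\<Sum>l\<in>UNIV. a $ l * s $ l) = 2 * (\<Sum>l\<in>UNIV. d l * s $ l)"
      by (simp add: b_def distrib_right sum.distrib sum_distrib_left mult.assoc)
    also have "\<dots> = 2 * - ((s $ i * u - 1) * s $ j)"
      unfolding dsum by (simp add: algebra_simps)
    finally have "M dvd (\<Sum>l\<in>UNIV. b $ l * s $ l) - (\<Sum>l\<in>UNIV. a $ l * s $ l)"
      using u M by (metis dvd_minus_iff dvd_mult2)
    moreover have "\<forall>l. odd (b $ l)" using a by (simp add: b_def)
    ultimately have "M dvd (\<Sum>l\<in>UNIV. signed_permutation \<sigma> e b $ l * s' $ l) -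
        (\<Sum>l\<in>UNIV. signed_permutation \<sigma> e a $ l * s' $ l)"
      by (intro lat)
    also have "(\<Sum>l\<in>UNIV. signed_permutation \<sigma> e b $ l * s' $ l) -
        (\<Sum>l\<in>UNIV. signed_permutation \<sigma> e a $ l * s' $ l) = 2 * (\<Sum>l\<in>UNIV. d l * t l)"
      unfolding signed_permutation_dot[OF \<sigma>] b_def t_def
      by (simp add: sum_distrib_left sum_subtractf[symmetric] algebra_simps)
    finally show ?thesis unfolding M dsum by (simp add: mult_ac)
  qed
  \<comment> \<open>As \<open>t j\<close> is congruent to \<open>u * t i * s $ j\<close>, the
    multiplier \<open>k\<close> has to be an inverse of \<open>u * t i\<close>.\<close>
  have "coprime (u * t i) (int q)"
  proof -
    have "coprime (t i) (int q)" using e[of i] s'[of "\<sigma> i"] by (auto simp: t_def)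
    moreover have "coprime u (int q)"
    proof (rule coprimeI)
      fix c assume "c dvd u" "c dvd int q"
      then have "c dvd s $ i * u" "c dvd s $ i * u - 1" using u by (auto intro: dvd_trans)
      then have "c dvd s $ i * u - (s $ i * u - 1)" by (rule dvd_diff)
      then show "is_unit c" by simp
    qed
    ultimately show ?thesis by simp
  qed
  then obtain v where "[u * t i * v = 1] (mod int q)" using cong_solve_coprime_int by blast
  \<comment> \<open>\<open>k\<close> is an exponent of the generator, so the inverse needs a
    representative in the natural numbers.\<close>
  moreover have "[int (nat (v mod int q)) = v] (mod int q)"
    using q by (simp add: cong_def)
  ultimately have "[u * t i * int (nat (v mod int q)) = 1] (mod int q)"
    by (meson cong_scalar_left cong_trans)
  then obtain k where k: "int q dvd u * t i * int k - 1"
    unfolding cong_iff_dvd_diff by blast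
  have "int q dvd e j * s $ j - int k * s' $ \<sigma> j" for j
  proof -
    have ee: "e j * e j = 1" using e[of j] by auto
    have "e j * s $ j - int k * s' $ \<sigma> j = e j * s $ j - int k * (e j * e j) * s' $ \<sigma> j"
      by (simp add: ee)
    also have "\<dots> = - (e j * s $ j * (u * t i * int k - 1)) - int k * e j * (t j - u * t i * s $ j)"
      by (simp add: t_def algebra_simps)
    finally show ?thesis using k proportional[of j] by (simp add: dvd_diff)
  qed
  then obtain n where "\<And>j. e j * s $ j - int k * s' $ \<sigma> j = int q * n j"
    unfolding dvd_def by metis
  then have "angle_match q s s' k \<sigma> e n"
    using \<sigma> e by (simp add: angle_match_def algebra_simps)
  then show thesis by (rule that)
qed

section \<open>The two equivalences\<close>

lemma odd_lens_isometry_iff: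
  fixes q :: nat and s s' :: "int ^ 'm::{finite,linorder}" and \<epsilon> :: int
  assumes q: "odd q" and s: "\<And>j. coprime (s $ j) (int q)" and s': "\<And>j. coprime (s' $ j) (int q)"
  shows "(\<exists>\<psi>. oriented_lens_isometry \<epsilon> q s s' \<psi>) \<longleftrightarrow>
    (\<exists>\<phi>. oriented_l1_isometry \<epsilon> \<phi> \<and> \<phi> ` lens_lattice q s = lens_lattice q s')"
proof
  have q0: "q > 0" using q by (cases q) auto
  note lattice_image_iff = l1_isometry_image_eq_iff[where
      C = "\<lambda>a. [(\<Sum>j\<in>UNIV. a $ j * s $ j) = 0] (mod int q)" and
      C' = "\<lambda>a. [(\<Sum>j\<in>UNIV. a $ j * s' $ j) = 0] (mod int q)", folded lens_lattice_def]
  {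
    assume "\<exists>\<psi>. oriented_lens_isometry \<epsilon> q s s' \<psi>"
    then obtain \<psi> \<Psi> where lift: "lens_lift q s s' \<psi> \<Psi>" and det: "det (matrix \<Psi>) = of_int \<epsilon>"
      by (auto simp: oriented_lens_isometry_def)
    have \<Psi>: "orthogonal_transformation \<Psi>" using lift by (simp add: lens_lift_def)
    obtain k where "\<And>v. \<Psi> (lens_generator q s v) = (lens_generator q s' ^^ k) (\<Psi> v)"
      using lens_lift_intertwines[OF lift] by blast
    then obtain \<sigma> e n where match: "angle_match q s s' k \<sigma> e n"
      and e: "det (matrix \<Psi>) = of_int (\<Prod>j\<in>UNIV. e j)"
      using lens_intertwiner_match[OF q0 s \<Psi>] by blast
    define \<phi> where
      "\<phi> x = (\<chi> i. of_int (e (inv \<sigma> i)) * x $ inv \<sigma> i)" for x :: "real ^ 'm::{finite,linorder}"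
    have "(\<Prod>j\<in>UNIV. e j) = \<epsilon>" using det e by (metis of_int_eq_iff)
    then have "oriented_l1_isometry \<epsilon> \<phi>"
      using angle_matchD(1,2)[OF match] unfolding oriented_l1_isometry_def
      by (intro exI[of _ \<sigma>] exI[of _ e]) (simp add: \<phi>_def)
    moreover have "\<phi> ` lens_lattice q s = lens_lattice q s'"
      unfolding lattice_image_iff[OF angle_matchD(1,2)[OF match] ballI, OF \<phi>_def]
      using angle_match_lens_lattice[OF match s] by blast
    ultimately show "\<exists>\<phi>. oriented_l1_isometry \<epsilon> \<phi> \<and> \<phi> ` lens_lattice q s = lens_lattice q s'"
      by blast
  next
    assume "\<exists>\<phi>. oriented_l1_isometry \<epsilon> \<phi> \<and> \<phi> ` lens_lattice q s = lens_lattice q s'"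
    then obtain \<phi> where oriented: "oriented_l1_isometry \<epsilon> \<phi>"
      and im: "\<phi> ` lens_lattice q s = lens_lattice q s'"
      by blast
    from oriented obtain \<sigma> e where \<sigma>: "bij \<sigma>" and e: "\<And>j. e j \<in> {-1, 1}"
      and prod: "(\<Prod>j\<in>UNIV. e j) = \<epsilon>"
      and \<phi>: "\<forall>x\<in>half_odd_vectors. \<phi> x = (\<chi> i. of_int (e (inv \<sigma> i)) * x $ inv \<sigma> i)"
      unfolding oriented_l1_isometry_def by blast
    have lat: "int q dvd (\<Sum>j\<in>UNIV. a $ j * s $ j) \<longleftrightarrow>
        int q dvd (\<Sum>j\<in>UNIV. signed_permutation \<sigma> e a $ j * s' $ j)" if "\<forall>j. odd (a $ j)" for a
      using im that unfolding lattice_image_iff[of \<sigma> e, OF \<sigma> e \<phi>] cong_0_iff by blast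
    obtain a where a: "\<forall>j. odd (a $ j)" "int q dvd (\<Sum>j\<in>UNIV. a $ j * s $ j)"
      using odd_orthogonal_vector_exists[OF s] q by blast
    obtain k n where match: "angle_match q s s' k \<sigma> e n"
    proof (rule lattice_isometry_angle_match[OF q0 s s' \<sigma> e _ a(1)])
      \<comment> \<open>2 is invertible modulo an odd \<open>q\<close>, so \<open>q\<close> itself
        can serve as the modulus \<open>M\<close>.\<close>
      show "int q dvd 2 * z \<longleftrightarrow> int q dvd z" for z
        using q by (simp add: coprime_dvd_mult_right_iff)
      show "int q dvd (\<Sum>j\<in>UNIV. signed_permutation \<sigma> e b $ j * s' $ j) -
          (\<Sum>j\<in>UNIV. signed_permutation \<sigma> e a $ j * s' $ j)"
        if "\<forall>j. odd (b $ j)" "int q dvd (\<Sum>j\<in>UNIV. b $ j * s $ j) - (\<Sum>j\<in>UNIV. a $ j * s $ j)" for b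
      proof (rule dvd_diff)
        have "int q dvd (\<Sum>j\<in>UNIV. b $ j * s $ j)"
          using that(2) a(2) by (simp add: dvd_diff_left_iff)
        then show "int q dvd (\<Sum>j\<in>UNIV. signed_permutation \<sigma> e b $ j * s' $ j)"
          using lat that(1) by blast
        show "int q dvd (\<Sum>j\<in>UNIV. signed_permutation \<sigma> e a $ j * s' $ j)"
          using lat a by blast
      qed
    qed blast
    let ?P = "block_permutation \<sigma> e"
    have "coprime k q" using angle_match_coprime[OF match s] by simp
    then have "lens_isometry q s s' (image ?P)" "lens_lift q s s' (image ?P) ?P"
      using intertwiner_lens_isometry[OF q0 _ orthogonal_transformation_block_permutation[of \<sigma> e, OF \<sigma> e]
        block_permutation_intertwines[OF q0 match]] by blast+
    moreover have "det (matrix ?P) = of_int \<epsilon>"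
      by (simp only: det_block_permutation[of \<sigma> e, OF \<sigma> e] prod)
    ultimately show "\<exists>\<psi>. oriented_lens_isometry \<epsilon> q s s' \<psi>"
      unfolding oriented_lens_isometry_def by blast
  }
qed

text \<open>Shifting \<open>h\<close> shifts both spin structures and both lattices alike, so both
  sides come down to one condition: \<open>\<rho> + floor_sum q s' + floor_sum q s\<close> plus the
  sum of the \<open>n j\<close> is even.\<close>

lemma even_spin_isometry_iff:
  fixes q :: nat and s s' :: "int ^ 'm::{finite,linorder}" and \<epsilon> \<rho> :: int
  assumes q0: "q > 0" and q: "even q" and m: "even CARD('m)"
    and s: "\<And>j. coprime (s $ j) (int q)" and s': "\<And>j. coprime (s' $ j) (int q)"
  shows "(\<exists>\<psi>. oriented_lens_isometry \<epsilon> q s s' \<psi> \<and>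
      (\<forall>h\<in>{0, 1}. takes_spin_structure q s s' \<psi>
        (spin_structure q s h) (spin_structure q s' (h + \<rho>)))) \<longleftrightarrow>
    (\<exists>\<phi>. oriented_l1_isometry \<epsilon> \<phi> \<and>
      (\<forall>h\<in>{0, 1}. \<phi> ` spin_lattice q s (h + floor_sum q s)
        = spin_lattice q s' (h + \<rho> + floor_sum q s')))"
proof
  let ?f = "floor_sum q s" and ?f' = "floor_sum q s'"
  note lattice_image_iff = l1_isometry_image_eq_iff[where
      C = "\<lambda>a. [(\<Sum>j\<in>UNIV. a $ j * s $ j) = h * int q] (mod (2 * int q))" and
      C' = "\<lambda>a. [(\<Sum>j\<in>UNIV. a $ j * s' $ j) = h' * int q] (mod (2 * int q))" for h h',
      folded spin_lattice_def]
  have cong_parity: "[h * int q = h' * int q] (mod (2 * int q)) \<longleftrightarrow> even (h - h')" for h h'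
    using q0 by (simp add: cong_iff_dvd_diff flip: left_diff_distrib)
  {
    assume "\<exists>\<psi>. oriented_lens_isometry \<epsilon> q s s' \<psi> \<and>
      (\<forall>h\<in>{0, 1}. takes_spin_structure q s s' \<psi>
        (spin_structure q s h) (spin_structure q s' (h + \<rho>)))"
    \<comment> \<open>The lift \<open>\<Phi>\<close> witnessing the orientation and the lift
      \<open>\<Psi>\<close> carrying the spin structure may differ; \<open>lens_lift_det_eq\<close>
      equates their determinants.\<close>
    then obtain \<psi> \<Phi> \<Psi> x where lift': "lens_lift q s s' \<psi> \<Phi>" "det (matrix \<Phi>) = of_int \<epsilon>"
      and lift: "lens_lift q s s' \<psi> \<Psi>" and x: "pin_lift x \<Psi>"
      and spin: "\<And>g. g \<in> lens_group q s \<Longrightarrow> spin_structure q s' (0 + \<rho>) (\<Psi> \<circ> g \<circ> inv \<Psi>) =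
        x * spin_structure q s 0 g * cl_inverse x"
      unfolding oriented_lens_isometry_def takes_spin_structure_def by blast
    have \<Psi>: "orthogonal_transformation \<Psi>" using lift by (simp add: lens_lift_def)
    obtain k where k: "\<Psi> \<circ> lens_generator q s \<circ> inv \<Psi> = lens_generator q s' ^^ k"
      and int: "\<And>v. \<Psi> (lens_generator q s v) = (lens_generator q s' ^^ k) (\<Psi> v)"
      using lens_lift_intertwines[OF lift] by blast
    then obtain \<sigma> e n where match: "angle_match q s s' k \<sigma> e n"
      and e: "det (matrix \<Psi>) = of_int (\<Prod>j\<in>UNIV. e j)"
      using lens_intertwiner_match[OF q0 s \<Psi>] by blast
    have "lens_generator q s \<in> lens_group q s"
      unfolding lens_group_def by (rule range_eqI[of _ _ 1]) simp
    then have "spin_structure q s' \<rho> (lens_generator q s' ^^ k) =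
        x * spin_structure q s 0 (lens_generator q s) * cl_inverse x"
      using spin k by fastforce
    then have parity: "even (\<rho> + ?f' + ?f + (\<Sum>j\<in>UNIV. n j))"
      using spin_structure_conjugate_iff[OF q0 q m s s' x \<Psi> int match e, of \<rho> 0] by simp
    define \<phi> where
      "\<phi> x = (\<chi> i. of_int (e (inv \<sigma> i)) * x $ inv \<sigma> i)" for x :: "real ^ 'm::{finite,linorder}"
    have "(\<Prod>j\<in>UNIV. e j) = \<epsilon>"
      using lens_lift_det_eq[OF lift'(1) lift] lift'(2) e by (metis of_int_eq_iff)
    then have "oriented_l1_isometry \<epsilon> \<phi>"
      using angle_matchD(1,2)[OF match] unfolding oriented_l1_isometry_def
      by (intro exI[of _ \<sigma>] exI[of _ e]) (simp add: \<phi>_def)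
    moreover have "\<phi> ` spin_lattice q s (h + ?f) = spin_lattice q s' (h + \<rho> + ?f')" for h
    proof -
      have "even (h + ?f - (\<Sum>j\<in>UNIV. n j) - (h + \<rho> + ?f'))" using parity by presburger
      then have c: "[(h + ?f - (\<Sum>j\<in>UNIV. n j)) * int q = (h + \<rho> + ?f') * int q] (mod (2 * int q))"
        unfolding cong_parity .
      show ?thesis
        unfolding lattice_image_iff[OF angle_matchD(1,2)[OF match] ballI, OF \<phi>_def]
      proof (intro allI impI)
        fix a :: "int ^ 'm::{finite,linorder}" assume "\<forall>j. odd (a $ j)"
        from angle_match_spin_lattice[OF q match s this, of "h + ?f"]
        show "[(\<Sum>j\<in>UNIV. a $ j * s $ j) = (h + ?f) * int q] (mod (2 * int q)) \<longleftrightarrow>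
            [(\<Sum>j\<in>UNIV. signed_permutation \<sigma> e a $ j * s' $ j) = (h + \<rho> + ?f') * int q] (mod (2 * int q))"
          using c by (meson cong_sym cong_trans)
      qed
    qed
    ultimately show "\<exists>\<phi>. oriented_l1_isometry \<epsilon> \<phi> \<and>
      (\<forall>h\<in>{0, 1}. \<phi> ` spin_lattice q s (h + ?f) = spin_lattice q s' (h + \<rho> + ?f'))"
      by blast
  next
    assume "\<exists>\<phi>. oriented_l1_isometry \<epsilon> \<phi> \<and>
      (\<forall>h\<in>{0, 1}. \<phi> ` spin_lattice q s (h + ?f) = spin_lattice q s' (h + \<rho> + ?f'))"
    then obtain \<phi> where oriented: "oriented_l1_isometry \<epsilon> \<phi>"
      and im: "\<And>h. h \<in> {0, 1} \<Longrightarrow> \<phi> ` spin_lattice q s (h + ?f) = spin_lattice q s' (h + \<rho> + ?f')"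
      by blast
    from oriented obtain \<sigma> e where \<sigma>: "bij \<sigma>" and e: "\<And>j. e j \<in> {-1, 1}"
      and prod: "(\<Prod>j\<in>UNIV. e j) = \<epsilon>"
      and \<phi>: "\<forall>x\<in>half_odd_vectors. \<phi> x = (\<chi> i. of_int (e (inv \<sigma> i)) * x $ inv \<sigma> i)"
      unfolding oriented_l1_isometry_def by blast
    obtain a where a: "\<forall>j. odd (a $ j)" "int q dvd (\<Sum>j\<in>UNIV. a $ j * s $ j)"
      using odd_orthogonal_vector_exists[OF s] m by blast
    then obtain H where H: "(\<Sum>j\<in>UNIV. a $ j * s $ j) = int q * H" by blast
    \<comment> \<open>The class whose lattice contains \<open>a\<close>: \<open>h + ?f\<close> is
      given the parity of \<open>H\<close>.\<close>
    define h where "h = (H - ?f) mod 2"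
    have "h \<in> {0, 1}" by (auto simp: h_def)
    have "even (H - (h + ?f))" unfolding h_def by presburger
    then have aH: "[(\<Sum>j\<in>UNIV. a $ j * s $ j) = (h + ?f) * int q] (mod (2 * int q))"
      unfolding H cong_parity[symmetric] by (simp add: mult.commute)
    have lat: "[(\<Sum>j\<in>UNIV. b $ j * s $ j) = (h + ?f) * int q] (mod (2 * int q)) \<longleftrightarrow>
        [(\<Sum>j\<in>UNIV. signed_permutation \<sigma> e b $ j * s' $ j) = (h + \<rho> + ?f') * int q] (mod (2 * int q))"
      if "\<forall>j. odd (b $ j)" for b
      using im[OF \<open>h \<in> {0, 1}\<close>] that unfolding lattice_image_iff[of \<sigma> e, OF \<sigma> e \<phi>] by blast
    obtain k n where match: "angle_match q s s' k \<sigma> e n"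
    proof (rule lattice_isometry_angle_match[OF q0 s s' \<sigma> e _ a(1)])
      show "2 * int q dvd 2 * z \<longleftrightarrow> int q dvd z" for z by simp
      show "2 * int q dvd (\<Sum>j\<in>UNIV. signed_permutation \<sigma> e b $ j * s' $ j) -
          (\<Sum>j\<in>UNIV. signed_permutation \<sigma> e a $ j * s' $ j)"
        if "\<forall>j. odd (b $ j)" "2 * int q dvd (\<Sum>j\<in>UNIV. b $ j * s $ j) - (\<Sum>j\<in>UNIV. a $ j * s $ j)" for b
        using that lat[of a] lat[of b] a(1) aH unfolding cong_iff_dvd_diff[symmetric]
        by (meson cong_sym cong_trans)
    qed blast
    \<comment> \<open>The image of \<open>a\<close> lies in the class predicted by the angle match
      and in the one prescribed for \<open>\<phi>\<close>, so these classes coincide.\<close>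
    have "[(h + ?f - (\<Sum>j\<in>UNIV. n j)) * int q = (h + \<rho> + ?f') * int q] (mod (2 * int q))"
      using angle_match_spin_lattice[OF q match s a(1), of "h + ?f"] lat[OF a(1)] aH
      by (meson cong_sym cong_trans)
    moreover have "even (h + f - N - (h + \<rho> + f')) \<longleftrightarrow> even (\<rho> + f' + f + N)" for f f' N
      by presburger
    ultimately have parity: "even (\<rho> + ?f' + ?f + (\<Sum>j\<in>UNIV. n j))"
      unfolding cong_parity by (simp only:)
    let ?P = "block_permutation \<sigma> e"
    note orth = orthogonal_transformation_block_permutation[of \<sigma> e, OF \<sigma> e]
      and int = block_permutation_intertwines[OF q0 match]
    have "coprime k q" using angle_match_coprime[OF match s] by simp
    note lens = intertwiner_lens_isometry[OF q0 this orth int]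
    have det: "det (matrix ?P) = of_int (\<Prod>j\<in>UNIV. e j)"
      by (rule det_block_permutation[OF \<sigma> e])
    obtain x where x: "pin_lift x ?P" using pin_lift_exists[OF orth] by blast
    have "takes_spin_structure q s s' (image ?P) (spin_structure q s h) (spin_structure q s' (h + \<rho>))" for h
    proof -
      have "h + \<rho> + ?f' + (h + ?f) + (\<Sum>j\<in>UNIV. n j) = 2 * h + (\<rho> + ?f' + ?f + (\<Sum>j\<in>UNIV. n j))"
        by simp
      also have "even \<dots>" by (rule dvd_add[OF dvd_triv_left parity])
      finally have "spin_structure q s' (h + \<rho>) (lens_generator q s' ^^ k) =
          x * spin_structure q s h (lens_generator q s) * cl_inverse x"
        unfolding spin_structure_conjugate_iff[OF q0 q m s s' x orth int match det] .
      then have "spin_structure q s' (h + \<rho>) (lens_generator q s' ^^ k) =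
          x * spin_structure q s h (lens_generator q s ^^ 1) * cl_inverse x"
        by simp
      then have "spin_power q s' (h + \<rho>) (k * l) = x * spin_power q s h l * cl_inverse x" for l
        unfolding spin_structure_power[OF q0 q m s] spin_structure_power[OF q0 q m s']
        by (rule spin_power_conjugate[OF x])
      then have "spin_structure q s' (h + \<rho>) (?P \<circ> g \<circ> inv ?P) = x * spin_structure q s h g * cl_inverse x"
        if "g \<in> lens_group q s" for g
        using that by (auto simp: lens_group_def lens(3) spin_structure_power[OF q0 q m s]
            spin_structure_power[OF q0 q m s'])
      then show ?thesis unfolding takes_spin_structure_def using lens(2) x by blast
    qed
    moreover have "oriented_lens_isometry \<epsilon> q s s' (image ?P)"
      unfolding oriented_lens_isometry_def using lens(1,2) det prod by auto
    ultimately show "\<exists>\<psi>. oriented_lens_isometry \<epsilon> q s s' \<psi> \<and>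
      (\<forall>h\<in>{0, 1}. takes_spin_structure q s s' \<psi>
        (spin_structure q s h) (spin_structure q s' (h + \<rho>)))"
      by blast
  }
qed

theorem corollary3p3:
  fixes q :: nat and s s' :: "int ^ 'm::{finite,linorder}" and \<epsilon> :: int
  assumes "q > 0"
    and "\<forall>j. coprime (s $ j) (int q)"
    and "\<forall>j. coprime (s' $ j) (int q)"
    and "\<epsilon> \<in> {1, -1}"
  shows "(odd q \<longrightarrow>
            (\<exists>\<psi>. oriented_lens_isometry \<epsilon> q s s' \<psi>) \<longleftrightarrow>
            (\<exists>\<phi>. oriented_l1_isometry \<epsilon> \<phi> \<and> \<phi> ` lens_lattice q s = lens_lattice q s'))
       \<and> (\<forall>\<rho>::int. even q \<and> even CARD('m) \<and> \<rho> \<in> {0, 1} \<longrightarrow>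
            (\<exists>\<psi>. oriented_lens_isometry \<epsilon> q s s' \<psi> \<and>
               (\<forall>h\<in>{0, 1}. takes_spin_structure q s s' \<psi>
                  (spin_structure q s h) (spin_structure q s' (h + \<rho>)))) \<longleftrightarrow>
            (\<exists>\<phi>. oriented_l1_isometry \<epsilon> \<phi> \<and>
               (\<forall>h\<in>{0, 1}. \<phi> ` spin_lattice q s (h + floor_sum q s)
                  = spin_lattice q s' (h + \<rho> + floor_sum q s'))))"
  using assms odd_lens_isometry_iff[of q s s' \<epsilon>] even_spin_isometry_iff[of q s s' \<epsilon>] by blast

end
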